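(* Let $d=2$. Suppose that (for every cell) the quadrature-point values of $u_h^n$ satisfy $\widetilde{\mathbf u}^{n,*,\mathrm{int}}\in[m,M]^L$ and $\mathbf u^{n,*,\mathrm{int}},\mathbf u^{n,*,\mathrm{ext}}\in\mathbb M$. Furthermore, suppose that (A1)–(A3) and the CFL constraint $$\max\Big\{\hat\sigma\,\big|\nabla_{\boldsymbol\xi}\cdot[\mathbf A_{K(t)}^{-1}\boldsymbol\omega(t)]\big|\,|K(t)|+\sum_{\nu=1}^3\lambda^n\ell_\nu:\ t\in[t_n,t_{n+1}]\Big\}\frac{\Delta t}{h^2}\le\frac{\pi\hat\sigma}{\tau^2\kappa^2}$$ are satisfied. Then the solution $u_h^{n+1}$ of the third order fully-discrete (TVD-RK3) ALE-DG method, revised by the bound preserving limiter, belongs to the interval $[m,M]$.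
   Context: **Moving mesh ($d=2$).** $\Omega\subseteq\mathbb R^2$ is an open convex polygon, $t_n<t_{n+1}$ are consecutive time levels in $[0,T]$, $\Delta t=t_{n+1}-t_n$, $t_{n+\frac12}=\frac12(t_n+t_{n+1})$. The meshes at $t_n,t_{n+1}$ are regular triangulations of $\Omega$ with the same topology (corresponding cells and vertices), cells positively oriented with respect to $K_{\rm ref}=\{\boldsymbol\xi\in\mathbb R^2:\xi_1,\xi_2\ge0,\ \xi_1+\xi_2\le1\}$. For corresponding vertices $\mathbf v_\ell^n,\mathbf v_\ell^{n+1}$ of a cell, $\mathbf v_\ell(t)=\mathbf v_\ell^n+\frac{t-t_n}{\Delta t}(\mathbf v_\ell^{n+1}-\mathbf v_\ell^n)$; $K(t)=\operatorname{int}\operatorname{conv}\{\mathbf v_1(t),\mathbf v_2(t),\mathbf v_3(t)\}$; $\mathbf A_{K(t)}=(\mathbf v_2(t)-\mathbf v_1(t),\mathbf v_3(t)-\mathbf v_1(t))$; $J_{K(t)}=\det\mathbf A_{K(t)}=2|K(t)|$; $\boldsymbol\chi_{K(t)}(\boldsymbol\xi,t)=\mathbf A_{K(t)}\boldsymbol\xi+\mathbf v_1(t)$; $\mathcal T_{(t)}$ is the set of cells. The grid velocity on $K_{\rm ref}$ is $\boldsymbol\omega(t)=\boldsymbol\omega(\boldsymbol\xi,t)=\frac{d}{dt}\boldsymbol\chi_{K(t)}(\boldsymbol\xi,t)$. A star denotes pull-back by $\boldsymbol\chi_{K(t)}$. For $\theta\in\{0,\frac12,1\}$ write $\mathbf A_{K^{n+\theta}}=\mathbf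 A_{K(t_n+\theta\Delta t)}$ and $\boldsymbol\omega^{n+\theta}=\boldsymbol\omega(t_n+\theta\Delta t)$. With $h_{K(t)}$ the diameter of $K(t)$, $\rho_{K(t)}$ the radius of the largest ball contained in $K(t)$, $h=\max_{t\in[0,T]}\max_{K(t)}h_{K(t)}$: (A1) $\overline\Omega=\bigcup_{K(t)\in\mathcal T_{(t)}}\overline{K(t)}$ for all $t\in[0,T]$; (A2) $J_{K(t)}>0$ for all $t$ and all cells; (A3) there are $\kappa,\tau>0$, independent of $h$, with $h_{K(t)}\le\kappa\rho_{K(t)}$ and $h\le\tau h_{K(t)}$ for all $t$ and all cells. $\mathbf n_\nu$, $\ell_\nu$ ($\nu=1,2,3$) are the outward normals and the lengths of the edges of $K_{\rm ref}$. **Flux.** The problem is $\partial_tu+\nabla\cdot\boldsymbol f(u)=0$ in $\Omega\times(0,T)$ with initial datum $u_0$, suitable boundary conditions and a suitable vector field $\boldsymbol f:\mathbb R\to\mathbb R^2$; $m=\min_\Omega u_0$, $M=\max_\Omega u_0$; $\boldsymbol g(\boldsymbol\omega,u)=\boldsymbol f(u)-\boldsymbol\omega u$. The Lax–Friedrichs flux is used: $$\widehat g(\boldsymbol\omega,u_1,u_2,\mathbf n)=\tfrac12[\lambda^nu_1+\boldsymbol g(\boldsymbol\omega,u_1)\cdot\mathbf n]-\tfrac12[\lambda^nu_2-\boldsymbol g(\boldsymbol\omega,u_2)\cdot\mathbf n],$$ $$\lambda^n=\max\{|\partial_u\boldsymbol g(\boldsymbol\omega,u)\cdot\mathbf n_{K(t)}|:\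 u\in[m,M],\ t\in[t_n,t_{n+1}]\},$$ where $\mathbf n_{K(t)}=J_{K(t)}\mathbf A_{K(t)}^{-T}\mathbf n_{K_{\rm ref}}$ is the normal of the cell and $\mathbf n_{K_{\rm ref}}$ the reference normal. **Quadrature.** $k$ is the polynomial degree, $N$ the smallest integer with $2N-3\ge k$. $\sigma_\beta$, $\beta=1,\dots,k+1$, are the weights for $[-\frac12,\frac12]$ of the $(k+1)$-point Gauss rule (exact to degree $2k+1$), used on each edge. The quadrature rule of Zhang, Xia and Shu for triangles is exact for polynomials of degree $k$, has positive weights, and its nodes are the edge Gauss points, with weights $\sigma_\beta\hat\sigma$, $\hat\sigma=\frac{2}{3N(N-1)}$, and $L=3(N-2)(k+1)$ interior points with weights $\widetilde\sigma_\gamma$; the weights are normalized so that the rule gives cell averages. $Q_K$ is the set of these nodes in the cell $K$. For a cell, $\widetilde{\mathbf u}^{n,*,\mathrm{int}}$ is the vector of the values of $u_h^{n,*}$ at the $L$ interior nodes, and $\mathbf u^{n,*,\mathrm{int}}$, $\mathbf u^{n,*,\mathrm{ext}}$ are the vectors of the values, taken from inside and outside the cell, at the edge Gauss points (indexed by edge $\nu=1,2,3$ and $\beta=1,\dots,k+1$). $\mathbb M$ is the set of $\mathbf v=(\mathbf v_1,\mathbf v_2,\mathbf v_3)$ with $\mathbf v_\nu=(v_{\nu,1},\dots,v_{\nu,k+1})\in[m,M]^{k+1}$. **TVD-RK3 ALE-DG method.** $u_h^n$ is, on each cell, the image of a polynomial of degree at most $k$ on $K_{\rm ref}$. With $|K^n|=|K(t_n)|$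 the stage areas are $$|K^{n,1}|=|K^n|+\Delta t\big(\nabla_{\boldsymbol\xi}\cdot[\mathbf A_{K^n}^{-1}\boldsymbol\omega^n]\big)|K^n|,$$ $$|K^{n,2}|=\tfrac34|K^n|+\tfrac14|K^{n,1}|+\tfrac{\Delta t}4\big(\nabla_{\boldsymbol\xi}\cdot[\mathbf A_{K^{n+1}}^{-1}\boldsymbol\omega^{n+1}]\big)|K^{n,1}|,$$ $$|K^{n+1}|=\tfrac13|K^n|+\tfrac23|K^{n,2}|+\tfrac{2\Delta t}3\big(\nabla_{\boldsymbol\xi}\cdot[\mathbf A_{K^{n+\frac12}}^{-1}\boldsymbol\omega^{n+\frac12}]\big)|K^{n,2}|,$$ and $J_{K^n}=2|K^n|$, $J_{K^{n,1}}=2|K^{n,1}|$, $J_{K^{n,2}}=2|K^{n,2}|$, $J_{K^{n+1}}=2|K^{n+1}|$. For a number $J$ and a time $t$ let $$\mathcal G(w^*,v^*,J,t)=\int_{K_{\rm ref}}J\mathbf A_{K(t)}^{-1}\boldsymbol g(\boldsymbol\omega(t),w^* )\cdot\nabla_{\boldsymbol\xi}v^*\,d\boldsymbol\xi-\sum_{\nu=1}^3\sum_{\beta=1}^{k+1}\sigma_\beta\ell_\nu\,\widehat g\big(\boldsymbol\omega_{\nu,\beta},w^{*,\mathrm{int}}_{\nu,\beta},w^{*,\mathrm{ext}}_{\nu,\beta},J\mathbf A_{K(t)}^{-T}\mathbf n_\nu\big)v^*_{\nu,\beta},$$ the subscript $\nu,\beta$ denoting the value at the $\beta$-th Gauss point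 of edge $\nu$. The stages satisfy, for all cells and all $v^*\in P^k(K_{\rm ref})$ (polynomials of degree at most $k$), with $(\cdot,\cdot)$ the $L^2(K_{\rm ref})$ inner product, $$J_{K^{n,1}}(u_h^{n,1,*},v^* )=J_{K^n}(u_h^{n,*},v^* )+\Delta t\,\mathcal G(u_h^{n,*},v^*,J_{K^n},t_n),$$ $$J_{K^{n,2}}(u_h^{n,2,*},v^* )=\tfrac34J_{K^n}(u_h^{n,*},v^* )+\tfrac14J_{K^{n,1}}(u_h^{n,1,*},v^* )+\tfrac{\Delta t}4\mathcal G(u_h^{n,1,*},v^*,J_{K^{n,1}},t_{n+1}),$$ $$J_{K^{n+1}}(u_h^{n+1,*},v^* )=\tfrac13J_{K^n}(u_h^{n,*},v^* )+\tfrac23J_{K^{n,2}}(u_h^{n,2,*},v^* )+\tfrac{2\Delta t}3\mathcal G(u_h^{n,2,*},v^*,J_{K^{n,2}},t_{n+\frac12}).$$ **Limiter.** Each computed stage solution ($u_h^{n,1}$, $u_h^{n,2}$, then $u_h^{n+1}$) is revised: on each cell $K$, with $\overline u$ the cell average of the stage solution $u$, it is replaced by $$\widetilde u=\Theta(u-\overline u)+\overline u,\quad\Theta=\min\Big\{\Big|\frac{M-\overline u}{M_K-\overline u}\Big|,\Big|\frac{m-\overline u}{m_K-\overline u}\Big|,1\Big\},\quad M_K=\max_{Q_K}u,\ m_K=\min_{Q_K}u.$$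
   Formalization: λ^n is the maximum also over the normals of stages 2 and 3 (with J_{K^{n,1}}, J_{K^{n,2}}), since with J_{K(t)} alone the claim fails; [m,M] is asserted at the nodes Q_K; suitable f is C^1, suitable boundary conditions keep exterior values in [m,M]. *)

theory Defs
  imports "HOL-Analysis.Analysis" "HOL-Computational_Algebra.Polynomial"
begin

text \<open>
  Cells are triples of vertex labels \<open>K :: 'v ^ 3\<close>, so that corresponding cells and vertices of
  the meshes at different times carry the same name, and \<open>P :: 'v \<Rightarrow> real ^ 2\<close> places the vertices
  at one instant.  Edges are numbered by the type \<open>3\<close> as well: edge \<open>\<nu>\<close> joins the local vertices
  \<open>\<nu>\<close> and \<open>\<nu> + 1\<close>, where \<open>3 + 1 = 1\<close>.  The discrete functions are represented by their pull-backs,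
  one function on the reference cell for each cell.
\<close>

section \<open>Reference cell\<close>

definition K_ref :: "(real ^ 2) set" where
  "K_ref = {\<xi>. 0 \<le> \<xi> $ 1 \<and> 0 \<le> \<xi> $ 2 \<and> \<xi> $ 1 + \<xi> $ 2 \<le> 1}"

definition ref_vertex :: "3 \<Rightarrow> real ^ 2" where
  "ref_vertex l = (if l = 1 then 0 else if l = 2 then axis 1 1 else axis 2 1)"

definition ref_edge :: "3 \<Rightarrow> (real ^ 2) set" where
  "ref_edge \<nu> = closed_segment (ref_vertex \<nu>) (ref_vertex (\<nu> + 1))"

definition edge_point :: "3 \<Rightarrow> real \<Rightarrow> real ^ 2" where
  "edge_point \<nu> s = (1/2 - s) *\<^sub>R ref_vertex \<nu> + (1/2 + s) *\<^sub>R ref_vertex (\<nu> + 1)"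

definition ref_length :: "3 \<Rightarrow> real" where
  "ref_length \<nu> = dist (ref_vertex \<nu>) (ref_vertex (\<nu> + 1))"

text \<open>The vertices run counterclockwise, so the outward normal is the edge direction turned
  clockwise by a right angle.\<close>

definition ref_normal :: "3 \<Rightarrow> real ^ 2" where
  "ref_normal \<nu> = (let e = ref_vertex (\<nu> + 1) - ref_vertex \<nu>
     in (1 / ref_length \<nu>) *\<^sub>R vector [e $ 2, - (e $ 1)])"

definition P_space :: "nat \<Rightarrow> (real ^ 2 \<Rightarrow> real) set" where
  "P_space k = {p. \<exists>c :: nat \<Rightarrow> nat \<Rightarrow> real.
     \<forall>\<xi>. p \<xi> = (\<Sum>i\<le>k. \<Sum>j\<le>k - i. c i j * (\<xi> $ 1) ^ i * (\<xi> $ 2) ^ j)}"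

definition gradient :: "(real ^ 2 \<Rightarrow> real) \<Rightarrow> real ^ 2 \<Rightarrow> real ^ 2" where
  "gradient v \<xi> = (\<chi> i. frechet_derivative v (at \<xi>) (axis i 1))"

definition divergence :: "(real ^ 2 \<Rightarrow> real ^ 2) \<Rightarrow> real ^ 2 \<Rightarrow> real" where
  "divergence F \<xi> = (\<Sum>i\<in>UNIV. frechet_derivative F (at \<xi>) (axis i 1) $ i)"

definition inner_ref :: "(real ^ 2 \<Rightarrow> real) \<Rightarrow> (real ^ 2 \<Rightarrow> real) \<Rightarrow> real" where
  "inner_ref w v = integral K_ref (\<lambda>\<xi>. w \<xi> * v \<xi>)"

text \<open>The map from the reference cell is affine, so the average over the reference cell is the
  average over the physical cell.\<close>

definition cell_average :: "(real ^ 2 \<Rightarrow> real) \<Rightarrow> real" where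
  "cell_average w = integral K_ref w / measure lebesgue K_ref"


section \<open>Geometry of a mesh at one instant\<close>

definition cell_hull :: "('v \<Rightarrow> real ^ 2) \<Rightarrow> 'v ^ 3 \<Rightarrow> (real ^ 2) set" where
  "cell_hull P K = convex hull (range (\<lambda>l. P (K $ l)))"

definition cell_set :: "('v \<Rightarrow> real ^ 2) \<Rightarrow> 'v ^ 3 \<Rightarrow> (real ^ 2) set" where
  "cell_set P K = interior (cell_hull P K)"

definition cell_matrix :: "('v \<Rightarrow> real ^ 2) \<Rightarrow> 'v ^ 3 \<Rightarrow> real ^ 2 ^ 2" where
  "cell_matrix P K =
     (\<chi> i j. (if j = 1 then P (K $ 2) - P (K $ 1) else P (K $ 3) - P (K $ 1)) $ i)"

definition cell_map :: "('v \<Rightarrow> real ^ 2) \<Rightarrow> 'v ^ 3 \<Rightarrow> real ^ 2 \<Rightarrow> real ^ 2" where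
  "cell_map P K \<xi> = cell_matrix P K *v \<xi> + P (K $ 1)"

definition cell_map_inv :: "('v \<Rightarrow> real ^ 2) \<Rightarrow> 'v ^ 3 \<Rightarrow> real ^ 2 \<Rightarrow> real ^ 2" where
  "cell_map_inv P K y = matrix_inv (cell_matrix P K) *v (y - P (K $ 1))"

definition inball_radius :: "(real ^ 2) set \<Rightarrow> real" where
  "inball_radius A = Sup {r. 0 < r \<and> (\<exists>c. ball c r \<subseteq> A)}"

definition mesh_vertices :: "('v ^ 3) set \<Rightarrow> 'v set" where
  "mesh_vertices \<T> = (\<Union>K\<in>\<T>. range (($) K))"

definition regular_mesh :: "(real ^ 2) set \<Rightarrow> ('v ^ 3) set \<Rightarrow> ('v \<Rightarrow> real ^ 2) \<Rightarrow> bool" where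
  "regular_mesh \<Omega> \<T> P \<longleftrightarrow>
     finite \<T> \<and> inj_on P (mesh_vertices \<T>) \<and> inj_on (cell_hull P) \<T> \<and>
     (\<forall>K\<in>\<T>. 0 < det (cell_matrix P K)) \<and>
     triangulation (cell_hull P ` \<T>) \<and>
     closure \<Omega> = (\<Union>K\<in>\<T>. cell_hull P K)"

definition neighbours :: "('v ^ 3) set \<Rightarrow> 'v ^ 3 \<Rightarrow> 3 \<Rightarrow> ('v ^ 3) set" where
  "neighbours \<T> K \<nu> = {K' \<in> \<T>. K' \<noteq> K \<and> {K $ \<nu>, K $ (\<nu> + 1)} \<subseteq> range (($) K')}"


section \<open>Data of the problem and of the discretization\<close>

text \<open>
  The value \<open>bdry S t w K \<nu> \<beta>\<close> is what the boundary conditions prescribe as exterior value at time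
  \<open>t\<close> on the boundary edge \<open>\<nu>\<close> of \<open>K\<close> when the discrete solution is \<open>w\<close>.  The dependence on \<open>w\<close>
  allows for periodic, outflow or reflecting conditions.
\<close>

record 'v ale_dg =
  Omega :: "(real ^ 2) set"
  cells :: "('v ^ 3) set"
  pos :: "real \<Rightarrow> 'v \<Rightarrow> real ^ 2"
  tlev :: "nat \<Rightarrow> real"
  nlev :: nat
  flux :: "real \<Rightarrow> real ^ 2"
  u_init :: "real ^ 2 \<Rightarrow> real"
  bdry :: "real \<Rightarrow> ('v ^ 3 \<Rightarrow> real ^ 2 \<Rightarrow> real) \<Rightarrow> 'v ^ 3 \<Rightarrow> 3 \<Rightarrow> nat \<Rightarrow> real"
  pdeg :: nat
  gauss_pt :: "nat \<Rightarrow> real"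
  gauss_wt :: "nat \<Rightarrow> real"
  int_pt :: "nat \<Rightarrow> real ^ 2"
  int_wt :: "nat \<Rightarrow> real"

definition final_time :: "'v ale_dg \<Rightarrow> real" where
  "final_time S = tlev S (nlev S)"

definition lo :: "'v ale_dg \<Rightarrow> real" where
  "lo S = (INF y\<in>Omega S. u_init S y)"

definition hi :: "'v ale_dg \<Rightarrow> real" where
  "hi S = (SUP y\<in>Omega S. u_init S y)"

definition Pk :: "'v ale_dg \<Rightarrow> (real ^ 2 \<Rightarrow> real) set" where
  "Pk S = P_space (pdeg S)"

subsection \<open>Quadrature\<close>

definition lobatto_N :: "nat \<Rightarrow> nat" where
  "lobatto_N k = (LEAST N. int k \<le> 2 * int N - 3)"

definition sigma_hat :: "'v ale_dg \<Rightarrow> real" where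
  "sigma_hat S = (let N = real (lobatto_N (pdeg S)) in 2 / (3 * N * (N - 1)))"

definition num_int :: "'v ale_dg \<Rightarrow> nat" where
  "num_int S = 3 * (lobatto_N (pdeg S) - 2) * (pdeg S + 1)"

definition edge_node :: "'v ale_dg \<Rightarrow> 3 \<Rightarrow> nat \<Rightarrow> real ^ 2" where
  "edge_node S \<nu> \<beta> = edge_point \<nu> (gauss_pt S \<beta>)"

definition quad_nodes :: "'v ale_dg \<Rightarrow> (real ^ 2) set" where
  "quad_nodes S = {edge_node S \<nu> \<beta> | \<nu> \<beta>. \<beta> \<in> {1..pdeg S + 1}} \<union> int_pt S ` {1..num_int S}"

definition gauss_rule :: "nat \<Rightarrow> (nat \<Rightarrow> real) \<Rightarrow> (nat \<Rightarrow> real) \<Rightarrow> bool" where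
  "gauss_rule k s \<sigma> \<longleftrightarrow>
     inj_on s {1..k + 1} \<and> s ` {1..k + 1} \<subseteq> {- 1/2..1/2} \<and>
     (\<forall>p :: real poly. degree p \<le> 2 * k + 1 \<longrightarrow>
        integral {- 1/2..1/2} (poly p) = (\<Sum>\<beta>\<in>{1..k + 1}. \<sigma> \<beta> * poly p (s \<beta>)))"

definition triangle_rule :: "'v ale_dg \<Rightarrow> bool" where
  "triangle_rule S \<longleftrightarrow>
     (\<forall>\<gamma>\<in>{1..num_int S}. int_pt S \<gamma> \<in> interior K_ref \<and> 0 < int_wt S \<gamma>) \<and>
     (\<forall>\<beta>\<in>{1..pdeg S + 1}. 0 < gauss_wt S \<beta> * sigma_hat S) \<and>
     (\<forall>p\<in>Pk S. cell_average p =
        (\<Sum>\<nu>\<in>UNIV. \<Sum>\<beta>\<in>{1..pdeg S + 1}. gauss_wt S \<beta> * sigma_hat S * p (edge_node S \<nu> \<beta>)) +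
        (\<Sum>\<gamma>\<in>{1..num_int S}. int_wt S \<gamma> * p (int_pt S \<gamma>)))"

text \<open>The set of edge values that respect the bounds.\<close>

definition edge_box :: "'v ale_dg \<Rightarrow> (3 \<Rightarrow> nat \<Rightarrow> real) set" where
  "edge_box S = {v. \<forall>\<nu>. \<forall>\<beta>\<in>{1..pdeg S + 1}. v \<nu> \<beta> \<in> {lo S..hi S}}"

subsection \<open>Standing assumptions\<close>

definition moving_mesh :: "'v ale_dg \<Rightarrow> bool" where
  "moving_mesh S \<longleftrightarrow>
     tlev S 0 = 0 \<and> (\<forall>j<nlev S. tlev S j < tlev S (Suc j)) \<and>
     (\<forall>j\<le>nlev S. regular_mesh (Omega S) (cells S) (pos S (tlev S j))) \<and>
     (\<forall>j<nlev S. \<forall>t\<in>{tlev S j..tlev S (Suc j)}. \<forall>v\<in>mesh_vertices (cells S).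
        pos S t v = pos S (tlev S j) v +
          ((t - tlev S j) / (tlev S (Suc j) - tlev S j)) *\<^sub>R
            (pos S (tlev S (Suc j)) v - pos S (tlev S j) v))"

text \<open>Boundary conditions are suitable for a maximum principle if the exterior values which they
  prescribe stay within the bounds as long as the discrete solution does.\<close>

definition suitable_bdry :: "'v ale_dg \<Rightarrow> bool" where
  "suitable_bdry S \<longleftrightarrow>
     (\<forall>t\<in>{0..final_time S}. \<forall>w.
        (\<forall>K\<in>cells S. w K \<in> Pk S \<and> (\<forall>\<xi>\<in>quad_nodes S. w K \<xi> \<in> {lo S..hi S})) \<longrightarrow>
        (\<forall>K\<in>cells S. \<forall>\<nu>. neighbours (cells S) K \<nu> = {} \<longrightarrow>
           (\<forall>\<beta>\<in>{1..pdeg S + 1}. bdry S t w K \<nu> \<beta> \<in> {lo S..hi S})))"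

definition ale_setting :: "'v ale_dg \<Rightarrow> bool" where
  "ale_setting S \<longleftrightarrow>
     open (Omega S) \<and> convex (Omega S) \<and> Omega S \<noteq> {} \<and> polytope (closure (Omega S)) \<and>
     moving_mesh S \<and>
     flux S C1_differentiable_on UNIV \<and>
     bounded (u_init S ` Omega S) \<and>
     suitable_bdry S \<and>
     gauss_rule (pdeg S) (gauss_pt S) (gauss_wt S) \<and>
     triangle_rule S"

section \<open>Moving geometry\<close>

definition K_at :: "'v ale_dg \<Rightarrow> 'v ^ 3 \<Rightarrow> real \<Rightarrow> (real ^ 2) set" where
  "K_at S K t = cell_set (pos S t) K"

definition A_at :: "'v ale_dg \<Rightarrow> 'v ^ 3 \<Rightarrow> real \<Rightarrow> real ^ 2 ^ 2" where
  "A_at S K t = cell_matrix (pos S t) K"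

definition J_at :: "'v ale_dg \<Rightarrow> 'v ^ 3 \<Rightarrow> real \<Rightarrow> real" where
  "J_at S K t = det (A_at S K t)"

definition area_at :: "'v ale_dg \<Rightarrow> 'v ^ 3 \<Rightarrow> real \<Rightarrow> real" where
  "area_at S K t = measure lebesgue (K_at S K t)"

definition h_at :: "'v ale_dg \<Rightarrow> 'v ^ 3 \<Rightarrow> real \<Rightarrow> real" where
  "h_at S K t = diameter (K_at S K t)"

definition rho_at :: "'v ale_dg \<Rightarrow> 'v ^ 3 \<Rightarrow> real \<Rightarrow> real" where
  "rho_at S K t = inball_radius (K_at S K t)"

definition h_max :: "'v ale_dg \<Rightarrow> real" where
  "h_max S = (SUP (K, t)\<in>cells S \<times> {0..final_time S}. h_at S K t)"

definition slab :: "'v ale_dg \<Rightarrow> nat \<Rightarrow> real set" where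
  "slab S n = {tlev S n..tlev S (Suc n)}"

definition dt :: "'v ale_dg \<Rightarrow> nat \<Rightarrow> real" where
  "dt S n = tlev S (Suc n) - tlev S n"

definition tmid :: "'v ale_dg \<Rightarrow> nat \<Rightarrow> real" where
  "tmid S n = (tlev S n + tlev S (Suc n)) / 2"

text \<open>The vertices move with a different velocity in every time slab; the derivative is taken
  within the slab under consideration, so it is one-sided at its ends.\<close>

definition grid_velocity :: "'v ale_dg \<Rightarrow> nat \<Rightarrow> 'v ^ 3 \<Rightarrow> real ^ 2 \<Rightarrow> real \<Rightarrow> real ^ 2" where
  "grid_velocity S n K \<xi> t =
     vector_derivative (\<lambda>s. cell_map (pos S s) K \<xi>) (at t within slab S n)"

text \<open>The field is affine in \<open>\<xi>\<close>, so its divergence does not depend on the point.\<close>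

definition grid_div :: "'v ale_dg \<Rightarrow> nat \<Rightarrow> 'v ^ 3 \<Rightarrow> real \<Rightarrow> real" where
  "grid_div S n K t = divergence (\<lambda>\<xi>. matrix_inv (A_at S K t) *v grid_velocity S n K \<xi> t) 0"

definition area_0 :: "'v ale_dg \<Rightarrow> nat \<Rightarrow> 'v ^ 3 \<Rightarrow> real" where
  "area_0 S n K = area_at S K (tlev S n)"

definition area_1 :: "'v ale_dg \<Rightarrow> nat \<Rightarrow> 'v ^ 3 \<Rightarrow> real" where
  "area_1 S n K = area_0 S n K + dt S n * grid_div S n K (tlev S n) * area_0 S n K"

definition area_2 :: "'v ale_dg \<Rightarrow> nat \<Rightarrow> 'v ^ 3 \<Rightarrow> real" where
  "area_2 S n K = 3/4 * area_0 S n K + 1/4 * area_1 S n K +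
     dt S n / 4 * grid_div S n K (tlev S (Suc n)) * area_1 S n K"

definition area_3 :: "'v ale_dg \<Rightarrow> nat \<Rightarrow> 'v ^ 3 \<Rightarrow> real" where
  "area_3 S n K = 1/3 * area_0 S n K + 2/3 * area_2 S n K +
     2 * dt S n / 3 * grid_div S n K (tmid S n) * area_2 S n K"

definition J_0 :: "'v ale_dg \<Rightarrow> nat \<Rightarrow> 'v ^ 3 \<Rightarrow> real" where "J_0 S n K = 2 * area_0 S n K"
definition J_1 :: "'v ale_dg \<Rightarrow> nat \<Rightarrow> 'v ^ 3 \<Rightarrow> real" where "J_1 S n K = 2 * area_1 S n K"
definition J_2 :: "'v ale_dg \<Rightarrow> nat \<Rightarrow> 'v ^ 3 \<Rightarrow> real" where "J_2 S n K = 2 * area_2 S n K"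
definition J_3 :: "'v ale_dg \<Rightarrow> nat \<Rightarrow> 'v ^ 3 \<Rightarrow> real" where "J_3 S n K = 2 * area_3 S n K"

definition cell_normal :: "'v ale_dg \<Rightarrow> 'v ^ 3 \<Rightarrow> 3 \<Rightarrow> real \<Rightarrow> real \<Rightarrow> real ^ 2" where
  "cell_normal S K \<nu> J t = J *\<^sub>R (transpose (matrix_inv (A_at S K t)) *v ref_normal \<nu>)"

section \<open>Lax--Friedrichs flux\<close>

definition ale_flux :: "'v ale_dg \<Rightarrow> real ^ 2 \<Rightarrow> real \<Rightarrow> real ^ 2" where
  "ale_flux S \<omega> u = flux S u - u *\<^sub>R \<omega>"

text \<open>
  The scheme evaluates the flux at the normals \<open>cell_normal S K \<nu> J t\<close> where \<open>J\<close> is the Jacobian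
  of the Runge--Kutta stage belonging to the time \<open>t\<close>.  For the second and third stage that is
  \<open>J_1\<close> at the end and \<open>J_2\<close> at the middle of the slab; these approximate the exact determinant
  \<open>J_at\<close> at these times but differ from it in general.  The viscosity coefficient has to dominate
  the wave speeds with respect to all normals in use, so \<open>J\<close> ranges over the exact determinant
  and the stage values.
\<close>

definition step_jacobians :: "'v ale_dg \<Rightarrow> nat \<Rightarrow> 'v ^ 3 \<Rightarrow> real \<Rightarrow> real set" where
  "step_jacobians S n K t =
     {J_at S K t} \<union> (if t = tlev S (Suc n) then {J_1 S n K} else {})
       \<union> (if t = tmid S n then {J_2 S n K} else {})"

definition lambda :: "'v ale_dg \<Rightarrow> nat \<Rightarrow> real" where
  "lambda S n = Sup {\<bar>vector_derivative (ale_flux S (grid_velocity S n K \<xi> t)) (at u)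
                        \<bullet> cell_normal S K \<nu> J t\<bar> | K \<nu> \<xi> u t J.
     K \<in> cells S \<and> \<xi> \<in> ref_edge \<nu> \<and> u \<in> {lo S..hi S} \<and> t \<in> slab S n \<and>
     J \<in> step_jacobians S n K t}"

definition lf_flux ::
  "'v ale_dg \<Rightarrow> nat \<Rightarrow> real ^ 2 \<Rightarrow> real \<Rightarrow> real \<Rightarrow> real ^ 2 \<Rightarrow> real" where
  "lf_flux S n \<omega> u1 u2 nrm =
     1/2 * (lambda S n * u1 + ale_flux S \<omega> u1 \<bullet> nrm)
     - 1/2 * (lambda S n * u2 - ale_flux S \<omega> u2 \<bullet> nrm)"

section \<open>Semi-discrete operator and limiter\<close>

text \<open>
  On an interior edge the exterior value is that of the neighbouring cell at the same physical
  point.  The neighbour is unique in a regular triangulation.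
\<close>

definition ext_value ::
  "'v ale_dg \<Rightarrow> ('v ^ 3 \<Rightarrow> real ^ 2 \<Rightarrow> real) \<Rightarrow> real \<Rightarrow> 'v ^ 3 \<Rightarrow> 3 \<Rightarrow> nat \<Rightarrow> real" where
  "ext_value S w t K \<nu> \<beta> =
     (if neighbours (cells S) K \<nu> = {} then bdry S t w K \<nu> \<beta>
      else (let K' = (SOME K'. K' \<in> neighbours (cells S) K \<nu>)
            in w K' (cell_map_inv (pos S t) K' (cell_map (pos S t) K (edge_node S \<nu> \<beta>)))))"

definition int_value ::
  "'v ale_dg \<Rightarrow> ('v ^ 3 \<Rightarrow> real ^ 2 \<Rightarrow> real) \<Rightarrow> 'v ^ 3 \<Rightarrow> 3 \<Rightarrow> nat \<Rightarrow> real" where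
  "int_value S w K \<nu> \<beta> = w K (edge_node S \<nu> \<beta>)"

definition dg_op ::
  "'v ale_dg \<Rightarrow> nat \<Rightarrow> 'v ^ 3 \<Rightarrow> ('v ^ 3 \<Rightarrow> real ^ 2 \<Rightarrow> real) \<Rightarrow> (real ^ 2 \<Rightarrow> real) \<Rightarrow>
     real \<Rightarrow> real \<Rightarrow> real" where
  "dg_op S n K w v J t =
     integral K_ref (\<lambda>\<xi>.
       (J *\<^sub>R (matrix_inv (A_at S K t) *v ale_flux S (grid_velocity S n K \<xi> t) (w K \<xi>)))
         \<bullet> gradient v \<xi>)
     - (\<Sum>\<nu>\<in>UNIV. \<Sum>\<beta>\<in>{1..pdeg S + 1}.
          gauss_wt S \<beta> * ref_length \<nu> *
          lf_flux S n (grid_velocity S n K (edge_node S \<nu> \<beta>) t)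
            (int_value S w K \<nu> \<beta>) (ext_value S w t K \<nu> \<beta>) (cell_normal S K \<nu> J t) *
          v (edge_node S \<nu> \<beta>))"

text \<open>A vanishing denominator imposes no restriction in the limiter.\<close>

definition limiter_ratio :: "real \<Rightarrow> real \<Rightarrow> real" where
  "limiter_ratio a b = (if b = 0 then 1 else \<bar>a / b\<bar>)"

definition limiter :: "'v ale_dg \<Rightarrow> (real ^ 2 \<Rightarrow> real) \<Rightarrow> real ^ 2 \<Rightarrow> real" where
  "limiter S u =
     (let a = cell_average u;
          \<Theta> = Min {limiter_ratio (hi S - a) (Max (u ` quad_nodes S) - a),
                   limiter_ratio (lo S - a) (Min (u ` quad_nodes S) - a), 1}
      in (\<lambda>\<xi>. \<Theta> * (u \<xi> - a) + a))"

definition revised ::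
  "'v ale_dg \<Rightarrow> ('v ^ 3 \<Rightarrow> real ^ 2 \<Rightarrow> real) \<Rightarrow> 'v ^ 3 \<Rightarrow> real ^ 2 \<Rightarrow> real" where
  "revised S w K = limiter S (w K)"

end

(* Testing the scheme with the constant 1 turns every Runge--Kutta stage into an equation for the
   cell averages.  By the triangle rule, the old average is a positive combination of nodal values,
   and the Lax--Friedrichs flux is monotone in both states, so the right-hand side is a nondecreasing
   function of the nodal values as soon as the edge weight sigma_hat times the stage area dominates
   dt * lambda * (edge length).  At constant states it reduces, because the Gauss rule integrates the
   affine grid velocity exactly over the edges, to the constant times the new stage area.  Hence the
   new average lies in [m, M], and the limiter brings the nodal values back into [m, M].

   The CFL condition is stated for the constant pi h^2 / (tau kappa)^2.  A ball of radius r in a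
   triangle forces its area to be at least 9/2 r^2 > pi r^2, so this constant is strictly below all
   cell areas.  The divergence term in the condition then controls how far the stage areas can drop,
   which keeps them positive and above the edge term. *)

theory Submission
  imports Defs
begin

section \<open>Geometry of triangles\<close>

text \<open>The adjugate formula makes every entry a quotient of matrix entries, from which
  continuity in time can be read off.\<close>

lemma matrix_inv_2:
  fixes A :: "real ^ 2 ^ 2"
  assumes "det A \<noteq> 0"
  shows "matrix_inv A = (\<chi> i j. (if i = 1 then (if j = 1 then A $ 2 $ 2 else - (A $ 1 $ 2))
     else (if j = 1 then - (A $ 2 $ 1) else A $ 1 $ 1)) / det A)" (is "_ = ?B")
proof -
  have d: "A $ 1 $ 1 * A $ 2 $ 2 - A $ 1 $ 2 * A $ 2 $ 1 \<noteq> 0"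
    using assms by (simp add: det_2)
  have AB: "A ** ?B = mat 1"
    using d by (simp add: vec_eq_iff matrix_matrix_mult_def mat_def forall_2 sum_2 det_2
        add_divide_distrib[symmetric] diff_divide_distrib[symmetric] mult.commute)
  have BA: "?B ** A = mat 1"
    using d by (simp add: vec_eq_iff matrix_matrix_mult_def mat_def forall_2 sum_2 det_2
        add_divide_distrib[symmetric] diff_divide_distrib[symmetric] mult.commute)
  show ?thesis
    unfolding matrix_inv_def
  proof (rule some_equality)
    show "A ** ?B = mat 1 \<and> ?B ** A = mat 1" using AB BA by (rule conjI)
  next
    fix C assume "A ** C = mat 1 \<and> C ** A = mat 1"
    then have CA: "C ** A = mat 1" by simp
    have "C = C ** (A ** ?B)" unfolding AB by (simp only: matrix_mul_rid)
    also have "\<dots> = ?B" unfolding matrix_mul_assoc CA by (simp only: matrix_mul_lid)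
    finally show "C = ?B" .
  qed
qed

lemma det_cell_matrix:
  "det (cell_matrix P K) =
     (P (K $ 2) $ 1 - P (K $ 1) $ 1) * (P (K $ 3) $ 2 - P (K $ 1) $ 2)
   - (P (K $ 3) $ 1 - P (K $ 1) $ 1) * (P (K $ 2) $ 2 - P (K $ 1) $ 2)"
  by (simp add: det_2 cell_matrix_def)

lemma cell_hull_eq: "cell_hull P K = convex hull {P (K $ 1), P (K $ 2), P (K $ 3)}"
proof -
  have "range (\<lambda>l. P (K $ l)) = {P (K $ 1), P (K $ 2), P (K $ 3)}"
    using exhaust_3 by (auto simp: image_iff) metis
  then show ?thesis by (simp add: cell_hull_def)
qed

lemma measure_cell_set: "measure lebesgue (cell_set P K) = \<bar>det (cell_matrix P K)\<bar> / 2"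
proof -
  have "compact (cell_hull P K)" "convex (cell_hull P K)"
    by (auto simp: cell_hull_eq compact_convex_hull)
  \<comment> \<open>The open cell and its closed hull differ by part of the frontier of a convex
    set, a null set.\<close>
  then have "measure lebesgue (cell_set P K) = measure lebesgue (cell_hull P K)"
    unfolding cell_set_def
    by (intro measure_interior negligible_convex_frontier compact_imp_bounded)
  also have "\<dots> = \<bar>det (cell_matrix P K)\<bar> / 2"
    using \<open>compact (cell_hull P K)\<close>
    by (simp add: measure_completion borel_compact cell_hull_eq content_triangle det_cell_matrix
        algebra_simps abs_minus_commute)
  finally show ?thesis .
qed

lemma K_ref_eq_hull: "K_ref = convex hull {0, axis 1 1, axis 2 1}"
proof (intro equalityI subsetI)
  fix x assume x: "x \<in> K_ref"
  have "x = (1 - x $ 1 - x $ 2) *\<^sub>R 0 + (x $ 1) *\<^sub>R axis 1 1 + (x $ 2) *\<^sub>R axis 2 1"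
    by (simp add: vec_eq_iff forall_2 axis_def)
  with x show "x \<in> convex hull {0, axis 1 1, axis 2 1}"
    unfolding convex_hull_3 K_ref_def mem_Collect_eq
    by (intro exI[of _ "1 - x $ 1 - x $ 2"] exI[of _ "x $ 1"] exI[of _ "x $ 2"]) auto
next
  fix x assume "x \<in> convex hull {0, axis 1 1 :: real ^ 2, axis 2 1}"
  then show "x \<in> K_ref"
    unfolding convex_hull_3 K_ref_def by (auto simp: axis_def)
qed

lemma measure_K_ref: "measure lebesgue K_ref = 1 / 2"
proof -
  have "measure lebesgue K_ref = measure lborel (convex hull {0, axis 1 1 :: real ^ 2, axis 2 1})"
    unfolding K_ref_eq_hull by (intro measure_completion) (simp add: borel_compact compact_convex_hull)
  also have "\<dots> = 1 / 2" unfolding content_triangle by (simp add: axis_def)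
  finally show ?thesis .
qed

lemma cell_average_const: "cell_average (\<lambda>_. c) = c"
proof -
  have "K_ref \<in> lmeasurable"
    by (simp add: K_ref_eq_hull lmeasurable_compact compact_convex_hull)
  then have "integral K_ref (\<lambda>_. 1) = (1 / 2 :: real)"
    by (simp add: lmeasure_integral[symmetric] measure_K_ref)
  then have "integral K_ref (\<lambda>_. c * 1) = c / 2"
    by (subst integral_mult_right) simp
  then show ?thesis by (simp add: cell_average_def measure_K_ref)
qed

section \<open>The largest inscribed ball and the area of a triangle\<close>

lemma ball_in_halfspace:
  fixes a c :: "'a :: euclidean_space"
  assumes "ball c r \<subseteq> {x. b \<le> a \<bullet> x}" "0 < r"
  shows "b + r * norm a \<le> a \<bullet> c"
proof (cases "a = 0")
  case True
  have "c \<in> ball c r" using assms(2) by simp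
  with assms(1) have "b \<le> a \<bullet> c" by blast
  then show ?thesis using True by simp
next
  case False
  have "closure (ball c r) \<subseteq> {x. b \<le> a \<bullet> x}"
    using assms(1) closed_halfspace_ge by (rule closure_minimal)
  \<comment> \<open>This is the point of the closed ball farthest in the direction
    \<open>- a\<close>; it lies in the closure, which suffices as the half-space is closed.\<close>
  moreover have "c - (r / norm a) *\<^sub>R a \<in> closure (ball c r)"
    using assms(2) False by (simp add: dist_norm)
  ultimately have "b \<le> a \<bullet> (c - (r / norm a) *\<^sub>R a)" by blast
  also have "\<dots> = a \<bullet> c - r * norm a"
    using False by (simp add: inner_diff_right dot_square_norm power2_eq_square)
  finally show ?thesis by simp
qed

text \<open>Twice the signed area of the triangle spanned by \<open>a\<close> and \<open>b\<close>,
  positive when \<open>b\<close> points to the left of \<open>a\<close>.\<close>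

definition cross2 :: "real ^ 2 \<Rightarrow> real ^ 2 \<Rightarrow> real" where
  "cross2 a b = a $ 1 * b $ 2 - a $ 2 * b $ 1"

text \<open>Turning \<open>a\<close> by a right angle keeps its norm and turns the cross product
  into an inner product, so Cauchy-Schwarz applies.\<close>

lemma cross2_le: "cross2 a b \<le> norm a * norm b"
proof -
  let ?a = "vector [- (a $ 2), a $ 1] :: real ^ 2"
  have "cross2 a b = ?a \<bullet> b"
    by (simp add: cross2_def inner_vec_def sum_2)
  also have "\<dots> \<le> norm ?a * norm b" by (rule norm_cauchy_schwarz)
  also have "norm ?a = norm a"
    by (simp add: norm_vec_def L2_set_def sum_2 add.commute)
  finally show ?thesis .
qed

text \<open>Divided by \<open>norm e\<close>, the cross product is the signed distance of
  \<open>c\<close> from the line through \<open>p\<close> along \<open>e\<close>, and the hull stays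
  on the left of that line because \<open>V\<close> does.\<close>

lemma ball_in_left_side:
  assumes "ball c r \<subseteq> convex hull V" "0 < r" "\<And>x. x \<in> V \<Longrightarrow> 0 \<le> cross2 e (x - p)"
  shows "r * norm e \<le> cross2 e (c - p)"
proof -
  let ?a = "vector [- (e $ 2), e $ 1] :: real ^ 2"
  have cross: "cross2 e (x - p) = ?a \<bullet> x - ?a \<bullet> p" for x
    by (simp add: cross2_def inner_vec_def sum_2 algebra_simps)
  have "convex hull V \<subseteq> {x. ?a \<bullet> p \<le> ?a \<bullet> x}"
    using assms(3) by (intro hull_minimal convex_halfspace_ge) (auto simp: cross)
  then have "?a \<bullet> p + r * norm ?a \<le> ?a \<bullet> c"
    using assms by (intro ball_in_halfspace) auto
  moreover have "norm ?a = norm e"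
    by (simp add: norm_vec_def L2_set_def sum_2 add.commute)
  ultimately show ?thesis by (simp add: cross)
qed

text \<open>The doubled area \<open>D\<close> is the sum of the doubled areas \<open>x\<^sub>i \<ge> r \<ell>\<^sub>i\<close> of the triangles over
  the edges with apex at the centre of the ball, and \<open>\<ell>\<^sub>i \<ell>\<^sub>j \<ge> D\<close>; hence
  \<open>D\<^sup>2 \<ge> 3 (x\<^sub>1 x\<^sub>2 + x\<^sub>2 x\<^sub>3 + x\<^sub>3 x\<^sub>1) \<ge> 9 r\<^sup>2 D\<close>.\<close>

lemma ball_in_triangle:
  assumes pos: "0 < det (cell_matrix P K)" and ball: "ball c r \<subseteq> cell_hull P K" and "0 < r"
  shows "9 * r\<^sup>2 \<le> det (cell_matrix P K)"
proof -
  define D p q s where "D = det (cell_matrix P K)"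
    and "p = P (K $ 1)" and "q = P (K $ 2)" and "s = P (K $ 3)"
  note defs = p_def[symmetric] q_def[symmetric] s_def[symmetric]
  have D: "D = cross2 (q - p) (s - q)" "D = cross2 (s - q) (p - s)" "D = cross2 (p - s) (q - p)"
    by (simp_all add: D_def det_cell_matrix cross2_def defs algebra_simps)
  have hull: "ball c r \<subseteq> convex hull {p, q, s}"
    using ball by (simp add: cell_hull_eq defs)
  have D0: "0 < D" using pos by (simp add: D_def)
  \<comment> \<open>Each cross product vanishes at the two ends of its edge and equals
    \<open>D\<close> at the opposite vertex.\<close>
  have side: "x \<in> {p, q, s} \<Longrightarrow> 0 \<le> cross2 (q - p) (x - p)"
    "x \<in> {p, q, s} \<Longrightarrow> 0 \<le> cross2 (s - q) (x - q)"
    "x \<in> {p, q, s} \<Longrightarrow> 0 \<le> cross2 (p - s) (x - s)" for x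
    using D0 unfolding D cross2_def by (auto simp: algebra_simps)
  define x1 x2 x3 where "x1 = cross2 (q - p) (c - p)" and "x2 = cross2 (s - q) (c - q)"
    and "x3 = cross2 (p - s) (c - s)"
  have x: "r * norm (q - p) \<le> x1" "r * norm (s - q) \<le> x2" "r * norm (p - s) \<le> x3"
    unfolding x1_def x2_def x3_def
    using ball_in_left_side[OF hull \<open>0 < r\<close>] side by blast+
  have prod: "r\<^sup>2 * D \<le> a * b"
    if "r * norm e \<le> a" "r * norm f \<le> b" "D = cross2 e f" for e f a b
  proof -
    have "r\<^sup>2 * D \<le> r\<^sup>2 * (norm e * norm f)"
      using cross2_le[of e f] that(3) by (intro mult_left_mono) auto
    also have "\<dots> = (r * norm e) * (r * norm f)" by (simp add: power2_eq_square)
    also have "\<dots> \<le> a * b"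
      using that \<open>0 < r\<close> by (intro mult_mono) (auto intro: order_trans[rotated])
    finally show ?thesis .
  qed
  have sum: "D = x1 + x2 + x3"
    unfolding D(1) x1_def x2_def x3_def cross2_def by (simp add: algebra_simps)
  have "9 * r\<^sup>2 * D \<le> 3 * (x1 * x2 + x2 * x3 + x3 * x1)"
    using prod[OF x(1,2) D(1)] prod[OF x(2,3) D(2)] prod[OF x(3,1) D(3)] by simp
  also have "\<dots> \<le> D\<^sup>2"
  proof -
    \<comment> \<open>The square of \<open>D\<close> exceeds the left-hand side by half of this sum
      of squares.\<close>
    have "0 \<le> (x1 - x2)\<^sup>2 + (x2 - x3)\<^sup>2 + (x3 - x1)\<^sup>2" by simp
    then show ?thesis unfolding sum by (simp add: power2_eq_square algebra_simps)
  qed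
  finally have "9 * r\<^sup>2 * D \<le> D * D" by (simp add: power2_eq_square)
  with D0 show ?thesis unfolding D_def[symmetric] by simp
qed

text \<open>The supremum of an empty set of reals is unspecified, so some inscribed ball has to be
  exhibited first; positive area provides it.\<close>

lemma inball_radius_le:
  assumes "0 < det (cell_matrix P K)"
  shows "inball_radius (cell_set P K) \<le> sqrt (det (cell_matrix P K)) / 3"
proof -
  have "measure lebesgue (cell_set P K) \<noteq> 0"
    using assms by (simp add: measure_cell_set)
  then have "cell_set P K \<noteq> {}" by auto
  moreover have "open (cell_set P K)" by (simp add: cell_set_def)
  ultimately obtain c r where "0 < r" "ball c r \<subseteq> cell_set P K"
    by (metis ex_in_conv openE)
  moreover have "r \<le> sqrt (det (cell_matrix P K)) / 3"
    if "0 < r" "ball c r \<subseteq> cell_set P K" for c r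
  proof -
    have "ball c r \<subseteq> cell_hull P K"
      using that(2) interior_subset unfolding cell_set_def by blast
    then have "9 * r\<^sup>2 \<le> det (cell_matrix P K)"
      using assms that(1) by (intro ball_in_triangle)
    then have "3 * r \<le> sqrt (det (cell_matrix P K))"
      by (intro real_le_rsqrt) (simp add: power2_eq_square)
    then show ?thesis by simp
  qed
  ultimately show ?thesis
    unfolding inball_radius_def by (intro cSup_least) auto
qed

lemma diameter_cell_set_pos:
  assumes "0 < det (cell_matrix P K)"
  shows "0 < diameter (cell_set P K)"
proof -
  have "measure lebesgue (cell_set P K) \<noteq> 0"
    using assms by (simp add: measure_cell_set)
  then have "cell_set P K \<noteq> {}" by auto
  moreover have "open (cell_set P K)" by (simp add: cell_set_def)
  ultimately obtain c r where r: "0 < r" "ball c r \<subseteq> cell_set P K"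
    by (metis ex_in_conv openE)
  have "bounded (cell_hull P K)"
    by (simp add: cell_hull_eq bounded_convex_hull)
  then have "bounded (cell_set P K)"
    using interior_subset unfolding cell_set_def by (rule bounded_subset)
  then have "diameter (ball c r) \<le> diameter (cell_set P K)"
    using r by (intro diameter_subset)
  then show ?thesis using r by simp
qed

section \<open>Quadrature and limiter\<close>

lemma gauss_rule_integral:
  fixes p :: "real poly"
  assumes "gauss_rule k s \<sigma>" "degree p \<le> 2 * k + 1"
  shows "integral {- 1/2..1/2} (poly p) = (\<Sum>\<beta>\<in>{1..k + 1}. \<sigma> \<beta> * poly p (s \<beta>))"
  using assms unfolding gauss_rule_def by blast

lemma gauss_rule_weight_sum:
  assumes "gauss_rule k s \<sigma>"
  shows "(\<Sum>\<beta>\<in>{1..k + 1}. \<sigma> \<beta>) = 1"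
proof -
  have "poly (1 :: real poly) = (\<lambda>_. 1)" by auto
  then show ?thesis
    using gauss_rule_integral[OF assms, of 1] by (simp del: sum.cl_ivl_Suc)
qed

text \<open>Exactness passes the symmetry of the interval on to the rule, although
  \<open>gauss_rule\<close> does not list any symmetry of nodes or weights.\<close>

lemma gauss_rule_reflect:
  fixes p :: "real poly"
  assumes "gauss_rule k s \<sigma>" "degree p \<le> 2 * k + 1"
  shows "(\<Sum>\<beta>\<in>{1..k + 1}. \<sigma> \<beta> * poly p (- s \<beta>)) = (\<Sum>\<beta>\<in>{1..k + 1}. \<sigma> \<beta> * poly p (s \<beta>))"
proof -
  let ?q = "p \<circ>\<^sub>p [:0, -1:]"
  have "degree ?q \<le> 2 * k + 1"
    using assms(2) by (simp add: degree_pcompose)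
  moreover have "poly ?q = (\<lambda>x. poly p (- x))"
    by (auto simp: poly_pcompose)
  moreover have "integral {- 1/2..1/2} (\<lambda>x. poly p (- x)) = integral {- 1/2..1/2} (poly p)"
    using Henstock_Kurzweil_Integration.integral_reflect_real[of "1/2" "- 1/2" "poly p"] by simp
  ultimately show ?thesis
    using gauss_rule_integral[OF assms(1), of ?q] gauss_rule_integral[OF assms]
    by (simp del: sum.cl_ivl_Suc)
qed

text \<open>This removes the part of the grid velocity that varies along an edge, so that only the
  mean of the end velocities remains.\<close>

lemma gauss_rule_first_moment:
  assumes "gauss_rule k s \<sigma>"
  shows "(\<Sum>\<beta>\<in>{1..k + 1}. \<sigma> \<beta> * s \<beta>) = 0"
  using gauss_rule_reflect[OF assms, of "[:0, 1:]"] by (simp add: sum_negf del: sum.cl_ivl_Suc)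

text \<open>The nodal polynomial and its reflection are monic of degree \<open>k + 1\<close> and orthogonal to all
  polynomials of degree at most \<open>k\<close>, hence equal.\<close>

lemma gauss_rule_symmetric:
  assumes g: "gauss_rule k s \<sigma>" and \<beta>: "\<beta> \<in> {1..k + 1}"
  shows "\<exists>\<beta>'\<in>{1..k + 1}. s \<beta>' = - s \<beta>"
proof -
  define q q' where "q = (\<Prod>j\<in>{1..k + 1}. [:- s j, 1:])" and "q' = (\<Prod>j\<in>{1..k + 1}. [:s j, 1:])"
  have deg: "degree q = k + 1" "degree q' = k + 1"
    unfolding q_def q'_def
    by (subst degree_prod_eq_sum_degree; simp del: prod.cl_ivl_Suc sum.cl_ivl_Suc)+
  have monic: "lead_coeff q = 1" "lead_coeff q' = 1"
    unfolding q_def q'_def by (simp_all add: lead_coeff_prod del: prod.cl_ivl_Suc)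
  have zero: "poly q (s j) = 0" "poly q' (- s j) = 0" if "j \<in> {1..k + 1}" for j
    unfolding q_def q'_def poly_prod using that
    by (auto intro!: prod_zero simp del: prod.cl_ivl_Suc)
  define d where "d = q - q'"
  \<comment> \<open>Both products are monic of degree \<open>k + 1\<close>, so the top coefficients
    cancel.\<close>
  have deg_d: "degree d \<le> k"
  proof (rule degree_le, intro allI impI)
    fix i assume "k < i"
    then consider "i = k + 1" | "k + 1 < i" by linarith
    then show "coeff d i = 0"
      by cases (use deg monic in \<open>simp_all add: d_def coeff_eq_0\<close>)
  qed
  let ?I = "integral {- 1/2..1/2} :: (real \<Rightarrow> real) \<Rightarrow> real"
  have deg_prod: "degree (q * d) \<le> 2 * k + 1" "degree (q' * d) \<le> 2 * k + 1"
    using deg deg_d degree_mult_le[of q d] degree_mult_le[of q' d] by linarith+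
  have "?I (poly (q * d)) = 0"
    unfolding gauss_rule_integral[OF g deg_prod(1)] using zero by (intro sum.neutral) simp
  \<comment> \<open>\<open>q'\<close> vanishes at the negated nodes, so the rule is reflected before
    its terms are seen to vanish.\<close>
  moreover have "?I (poly (q' * d)) = 0"
    unfolding gauss_rule_integral[OF g deg_prod(2)] gauss_rule_reflect[OF g deg_prod(2), symmetric]
    using zero by (intro sum.neutral) simp
  moreover have "?I (poly (d * d)) = ?I (poly (q * d)) - ?I (poly (q' * d))"
  proof -
    have "poly (d * d) = (\<lambda>x. poly (q * d) x - poly (q' * d) x)"
      by (auto simp: d_def algebra_simps)
    then show ?thesis
      by (simp only:) (intro integral_diff integrable_continuous_real continuous_intros)
  qed
  moreover have "poly (d * d) = (\<lambda>x. (poly d x)\<^sup>2)"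
    by (auto simp: power2_eq_square)
  ultimately have "?I (\<lambda>x. (poly d x)\<^sup>2) = 0" by simp
  then have "poly d x = 0" if "x \<in> {- 1/2..1/2}" for x
  proof -
    have "continuous_on {- 1/2..1/2} (\<lambda>x. (poly d x)\<^sup>2)" by (intro continuous_intros)
    with that \<open>?I (\<lambda>x. (poly d x)\<^sup>2) = 0\<close> show ?thesis
      using integral_eq_0_iff[of "- 1/2" "1/2" "\<lambda>x. (poly d x)\<^sup>2"] by auto
  qed
  then have "infinite {x. poly d x = 0}"
    by (rule_tac infinite_super[of "{- 1/2..1/2}"]) auto
  then have "d = 0" using poly_roots_finite by blast
  \<comment> \<open>The negated node is a root of \<open>q'\<close>, hence of \<open>q\<close>,
    whose only roots are the nodes.\<close>
  then have "poly q (- s \<beta>) = 0" using zero(2)[OF \<beta>] by (simp add: d_def)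
  then obtain \<beta>' where "\<beta>' \<in> {1..k + 1}" "poly [:- s \<beta>', 1:] (- s \<beta>) = 0"
    unfolding q_def poly_prod prod_zero_iff[OF finite_atLeastAtMost] by blast
  then show ?thesis by (intro bexI[of _ \<beta>']) auto
qed

section \<open>The polynomial space and the limiter\<close>

lemma const_in_P_space: "(\<lambda>_. a) \<in> P_space k"
proof -
  have "(\<Sum>i\<le>k. \<Sum>j\<le>k - i. (if i = 0 \<and> j = 0 then a else 0) * x ^ i * y ^ j) = a"
    for x y :: real
  proof -
    have "(\<Sum>i\<le>k. \<Sum>j\<le>k - i. (if i = 0 \<and> j = 0 then a else 0) * x ^ i * y ^ j)
        = (\<Sum>i\<le>k. \<Sum>j\<le>k - i. if j = 0 then if i = 0 then a else 0 else 0)"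
      (is "_ = ?R")
      by (intro sum.cong) auto
    also have "?R = a" by simp
    finally show ?thesis .
  qed
  then show ?thesis
    unfolding P_space_def
    by (auto intro!: exI[of _ "\<lambda>i j. if i = 0 \<and> j = 0 then a else 0"])
qed

lemma affine_in_P_space:
  assumes "p \<in> P_space k" "q \<in> P_space k"
  shows "(\<lambda>\<xi>. c * p \<xi> + q \<xi>) \<in> P_space k"
proof -
  obtain a b :: "nat \<Rightarrow> nat \<Rightarrow> real"
    where "\<And>\<xi>. p \<xi> = (\<Sum>i\<le>k. \<Sum>j\<le>k - i. a i j * (\<xi> $ 1) ^ i * (\<xi> $ 2) ^ j)"
      and "\<And>\<xi>. q \<xi> = (\<Sum>i\<le>k. \<Sum>j\<le>k - i. b i j * (\<xi> $ 1) ^ i * (\<xi> $ 2) ^ j)"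
    using assms unfolding P_space_def by auto
  then have "c * p \<xi> + q \<xi> = (\<Sum>i\<le>k. \<Sum>j\<le>k - i. (c * a i j + b i j) * (\<xi> $ 1) ^ i * (\<xi> $ 2) ^ j)" for \<xi>
    by (simp add: sum_distrib_left sum.distrib algebra_simps)
  then show ?thesis unfolding P_space_def
    by (auto intro!: exI[of _ "\<lambda>i j. c * a i j + b i j"])
qed

text \<open>The quadrature identity for averages holds on this space, and the next stage applies it
  to the limited function.\<close>

lemma limiter_in_Pk:
  assumes "p \<in> Pk S"
  shows "limiter S p \<in> Pk S"
proof -
  have "(\<lambda>\<xi>. c * (p \<xi> - a) + a) \<in> Pk S" for c a
    using affine_in_P_space[of p "pdeg S" "\<lambda>_. a - c * a" c] const_in_P_space[of "a - c * a" "pdeg S"] assms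
    by (simp add: Pk_def algebra_simps)
  then show ?thesis by (simp add: limiter_def Let_def)
qed

lemma finite_quad_nodes: "finite (quad_nodes S)"
proof -
  have "quad_nodes S =
      (\<lambda>(\<nu>, \<beta>). edge_node S \<nu> \<beta>) ` (UNIV \<times> {1..pdeg S + 1}) \<union> int_pt S ` {1..num_int S}"
    unfolding quad_nodes_def by (auto simp: image_iff) blast
  then show ?thesis by simp
qed

text \<open>A node above the average makes \<open>Mx - a\<close> positive, so the ratio is a genuine
  quotient and scales the largest overshoot down to \<open>hi S - a\<close>; a node below is
  symmetric. The bounds on the average settle the signs under the absolute values.\<close>

lemma limiter_bounds:
  assumes avg: "cell_average p \<in> {lo S..hi S}" and \<xi>: "\<xi> \<in> quad_nodes S"
  shows "limiter S p \<xi> \<in> {lo S..hi S}"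
proof -
  define a Mx Mn where "a = cell_average p" and "Mx = Max (p ` quad_nodes S)"
    and "Mn = Min (p ` quad_nodes S)"
  define \<Theta> where "\<Theta> = Min {limiter_ratio (hi S - a) (Mx - a), limiter_ratio (lo S - a) (Mn - a), 1}"
  have lim: "limiter S p \<xi> = \<Theta> * (p \<xi> - a) + a"
    by (simp add: limiter_def Let_def \<Theta>_def a_def Mx_def Mn_def)
  have bnd: "p \<xi> \<le> Mx" "Mn \<le> p \<xi>"
    unfolding Mx_def Mn_def using \<xi>
    by (auto intro!: Max_ge Min_le finite_imageI finite_quad_nodes)
  have \<Theta>: "0 \<le> \<Theta>" "\<Theta> \<le> limiter_ratio (hi S - a) (Mx - a)" "\<Theta> \<le> limiter_ratio (lo S - a) (Mn - a)"
    unfolding \<Theta>_def limiter_ratio_def by auto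
  have a: "lo S \<le> a" "a \<le> hi S" using avg by (auto simp: a_def)
  have "\<Theta> * (p \<xi> - a) \<le> hi S - a"
  proof (cases "p \<xi> \<le> a")
    case True
    then show ?thesis using \<Theta>(1) a by (smt (verit) mult_nonneg_nonpos)
  next
    case False
    then have pos: "0 < Mx - a" using bnd by simp
    have "\<Theta> * (p \<xi> - a) \<le> \<Theta> * (Mx - a)" using \<Theta>(1) bnd by (intro mult_left_mono) auto
    also have "\<dots> \<le> (hi S - a) / (Mx - a) * (Mx - a)"
      using \<Theta>(2) pos a by (intro mult_right_mono) (auto simp: limiter_ratio_def)
    also have "\<dots> = hi S - a" using pos by simp
    finally show ?thesis .
  qed
  moreover have "lo S - a \<le> \<Theta> * (p \<xi> - a)"
  proof (cases "a \<le> p \<xi>")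
    case True
    then show ?thesis using \<Theta>(1) a by (smt (verit) mult_nonneg_nonneg)
  next
    case False
    then have pos: "0 < a - Mn" using bnd by simp
    have "\<Theta> * (a - p \<xi>) \<le> \<Theta> * (a - Mn)" using \<Theta>(1) bnd by (intro mult_left_mono) auto
    also have "\<dots> \<le> (a - lo S) / (a - Mn) * (a - Mn)"
    proof (rule mult_right_mono)
      have "limiter_ratio (lo S - a) (Mn - a) = (a - lo S) / (a - Mn)"
        using pos a by (simp add: limiter_ratio_def abs_minus_commute)
      then show "\<Theta> \<le> (a - lo S) / (a - Mn)" using \<Theta>(3) by simp
    qed (use pos in simp)
    also have "\<dots> = a - lo S" using pos by simp
    finally show ?thesis by (simp add: algebra_simps)
  qed
  ultimately show ?thesis by (simp add: lim)
qed

text \<open>The defining inequality is one of integers, so it excludes 0 and 1 even for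
  \<open>k = 0\<close>; thus the denominator of \<open>sigma_hat\<close> is positive. The witness
  \<open>k + 2\<close> gives 2k + 1 on the right.\<close>

lemma two_le_lobatto_N: "2 \<le> lobatto_N k"
proof -
  have "int k \<le> 2 * int (lobatto_N k) - 3"
    unfolding lobatto_N_def by (rule LeastI[of _ "k + 2"]) simp
  then show ?thesis by linarith
qed

lemma sigma_hat_pos: "0 < sigma_hat S"
proof -
  have "2 \<le> real (lobatto_N (pdeg S))"
    using two_le_lobatto_N of_nat_mono by fastforce
  then show ?thesis by (simp add: sigma_hat_def Let_def)
qed

section \<open>Affine cell maps, edges and normals\<close>

lemma cell_map_eq:
  "cell_map P K \<xi> = P (K $ 1) + (\<xi> $ 1) *\<^sub>R (P (K $ 2) - P (K $ 1)) + (\<xi> $ 2) *\<^sub>R (P (K $ 3) - P (K $ 1))"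
  by (simp add: cell_map_def cell_matrix_def vec_eq_iff forall_2 matrix_vector_mult_def sum_2 mult.commute)

text \<open>Vertex numbers are cyclic in the type \<open>3\<close>, but simplification turns
  \<open>3 + 1\<close> into the numeral \<open>4\<close>.\<close>

lemma four_eq_one_3: "(4 :: 3) = 1"
  by simp

text \<open>An affine map preserves barycentric parameters, so the image depends on the two end
  vertices only; this is why cells sharing an edge agree on it.\<close>

lemma cell_map_edge_point:
  "cell_map P K (edge_point \<nu> s) = (1/2 - s) *\<^sub>R P (K $ \<nu>) + (1/2 + s) *\<^sub>R P (K $ (\<nu> + 1))"
  using exhaust_3[of \<nu>]
  by (elim disjE; hypsubst; simp add: four_eq_one_3 cell_map_eq edge_point_def ref_vertex_def axis_def vec_eq_iff forall_2 field_simps)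

lemma cell_map_inv_cell_map:
  assumes "det (cell_matrix P K) \<noteq> 0"
  shows "cell_map_inv P K (cell_map P K \<xi>) = \<xi>"
proof -
  have "invertible (cell_matrix P K)" using assms by (simp add: invertible_det_nz)
  then have "matrix_inv (cell_matrix P K) ** cell_matrix P K = mat 1"
    unfolding invertible_def matrix_inv_def by (rule someI2_ex) simp
  then show ?thesis
    by (simp add: cell_map_inv_def cell_map_def matrix_vector_mul_assoc)
qed

lemma ref_length_pos: "0 < ref_length \<nu>"
  using exhaust_3[of \<nu>]
  by (auto simp: ref_length_def ref_vertex_def axis_def vec_eq_iff)

text \<open>Weighting by the edge length cancels the normalization, so the hypotenuse brings no
  square root into the computations.\<close>

lemma scaled_ref_normal:
  "ref_length \<nu> *\<^sub>R ref_normal \<nu> =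
     vector [(ref_vertex (\<nu> + 1) - ref_vertex \<nu>) $ 2, - ((ref_vertex (\<nu> + 1) - ref_vertex \<nu>) $ 1)]"
  using ref_length_pos[of \<nu>] by (simp add: ref_normal_def Let_def)

lemma edge_point_in_ref_edge:
  assumes "s \<in> {- 1/2..1/2}"
  shows "edge_point \<nu> s \<in> ref_edge \<nu>"
  unfolding ref_edge_def edge_point_def closed_segment_def
  using assms by (auto intro!: exI[of _ "1/2 + s"])

lemma transpose_matrix_inv_mult_2:
  fixes A :: "real ^ 2 ^ 2"
  assumes "det A \<noteq> 0"
  shows "transpose (matrix_inv A) *v b =
    ((A $ 2 $ 2 * b $ 1 - A $ 2 $ 1 * b $ 2) / det A) *\<^sub>R axis 1 1
    + ((A $ 1 $ 1 * b $ 2 - A $ 1 $ 2 * b $ 1) / det A) *\<^sub>R axis 2 1"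
  unfolding matrix_inv_2[OF assms]
  by (simp add: vec_eq_iff forall_2 matrix_vector_mult_def sum_2 transpose_def axis_def
      diff_divide_distrib)

text \<open>\<open>V\<close> need not be a placement of vertices: with vertex velocities in its
  place, \<open>cell_map V K\<close> is the grid velocity.\<close>

lemma divergence_matrix_affine:
  fixes B :: "real ^ 2 ^ 2"
  assumes "\<And>\<xi>. F \<xi> = cell_map V K \<xi>"
  shows "divergence (\<lambda>\<xi>. B *v F \<xi>) x = trace (B ** cell_matrix V K)"
proof -
  have "linear (\<lambda>\<xi>. (B ** cell_matrix V K) *v \<xi>)" by simp
  then have "((\<lambda>\<xi>. (B ** cell_matrix V K) *v \<xi> + B *v V (K $ 1)) has_derivative
      (\<lambda>\<xi>. (B ** cell_matrix V K) *v \<xi>)) (at x)"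
    by (intro has_derivative_add_const linear_imp_has_derivative)
  moreover have "(\<lambda>\<xi>. B *v F \<xi>) = (\<lambda>\<xi>. (B ** cell_matrix V K) *v \<xi> + B *v V (K $ 1))"
    using assms by (auto simp: cell_map_def matrix_vector_right_distrib matrix_vector_mul_assoc)
  ultimately have "frechet_derivative (\<lambda>\<xi>. B *v F \<xi>) (at x) = (\<lambda>\<xi>. (B ** cell_matrix V K) *v \<xi>)"
    by (simp add: frechet_derivative_at[symmetric])
  then show ?thesis
    by (simp add: divergence_def trace_def matrix_vector_mult_basis column_def)
qed

lemma gradient_const: "gradient (\<lambda>_. c) \<xi> = 0"
  by (simp add: gradient_def vec_eq_iff)

section \<open>Cell averages as convex combinations of nodal values\<close>

lemma weighted_sum_bounds:
  fixes a :: "'b \<Rightarrow> real"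
  assumes "\<And>x. x \<in> X \<Longrightarrow> 0 \<le> a x" "\<And>x. x \<in> X \<Longrightarrow> f x \<in> {l..h}"
  shows "(\<Sum>x\<in>X. a x * f x) \<in> {(\<Sum>x\<in>X. a x) * l..(\<Sum>x\<in>X. a x) * h}"
  using assms unfolding sum_distrib_right atLeastAtMost_iff
  by (auto intro!: sum_mono mult_left_mono)

lemma edge_node_in_quad_nodes: "\<beta> \<in> {1..pdeg S + 1} \<Longrightarrow> edge_node S \<nu> \<beta> \<in> quad_nodes S"
  unfolding quad_nodes_def by blast

lemma int_pt_in_quad_nodes: "\<gamma> \<in> {1..num_int S} \<Longrightarrow> int_pt S \<gamma> \<in> quad_nodes S"
  unfolding quad_nodes_def by blast

lemma gauss_wt_pos:
  assumes "triangle_rule S" "\<beta> \<in> {1..pdeg S + 1}"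
  shows "0 < gauss_wt S \<beta>"
  using assms sigma_hat_pos[of S] unfolding triangle_rule_def
  by (meson zero_less_mult_pos2)

lemma int_wt_pos:
  assumes "triangle_rule S" "\<gamma> \<in> {1..num_int S}"
  shows "0 < int_wt S \<gamma>"
  using assms unfolding triangle_rule_def by blast

lemma quadrature_eq:
  assumes "triangle_rule S" "p \<in> Pk S"
  shows "cell_average p = (\<Sum>\<nu>\<in>UNIV. \<Sum>\<beta>\<in>{1..pdeg S + 1}. gauss_wt S \<beta> * sigma_hat S * p (edge_node S \<nu> \<beta>))
    + (\<Sum>\<gamma>\<in>{1..num_int S}. int_wt S \<gamma> * p (int_pt S \<gamma>))"
  using assms unfolding triangle_rule_def by blast

text \<open>Exactness for the constant 1 makes the positive weights add up to one.\<close>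

lemma cell_average_bounds:
  assumes rule: "triangle_rule S" and p: "p \<in> Pk S" "\<And>\<xi>. \<xi> \<in> quad_nodes S \<Longrightarrow> p \<xi> \<in> {l..h}"
  shows "cell_average p \<in> {l..h}"
proof -
  let ?E = "UNIV \<times> {1..pdeg S + 1} :: (3 \<times> nat) set"
  let ?e = "\<lambda>(\<nu>, \<beta>). gauss_wt S \<beta> * sigma_hat S" and ?I = "{1..num_int S}"
  have avg: "cell_average q = (\<Sum>(\<nu>, \<beta>)\<in>?E. gauss_wt S \<beta> * sigma_hat S * q (edge_node S \<nu> \<beta>))
      + (\<Sum>\<gamma>\<in>?I. int_wt S \<gamma> * q (int_pt S \<gamma>))" if "q \<in> Pk S" for q
    using quadrature_eq[OF rule that] unfolding sum.cartesian_product .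
  have one: "(\<Sum>x\<in>?E. ?e x) + (\<Sum>\<gamma>\<in>?I. int_wt S \<gamma>) = 1"
    using avg[of "\<lambda>_. 1"] const_in_P_space[of 1 "pdeg S"] cell_average_const[of 1]
    by (simp add: Pk_def)
  have "(\<Sum>x\<in>?E. ?e x * p (edge_node S (fst x) (snd x))) \<in> {(\<Sum>x\<in>?E. ?e x) * l..(\<Sum>x\<in>?E. ?e x) * h}"
    using p(2)[OF edge_node_in_quad_nodes] gauss_wt_pos[OF rule] sigma_hat_pos[of S]
    by (intro weighted_sum_bounds) (auto simp del: One_nat_def simp: less_imp_le)
  moreover have "(\<Sum>\<gamma>\<in>?I. int_wt S \<gamma> * p (int_pt S \<gamma>)) \<in>
      {(\<Sum>\<gamma>\<in>?I. int_wt S \<gamma>) * l..(\<Sum>\<gamma>\<in>?I. int_wt S \<gamma>) * h}"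
    using p(2)[OF int_pt_in_quad_nodes] int_wt_pos[OF rule]
    by (intro weighted_sum_bounds) (auto simp del: One_nat_def intro: less_imp_le)
  moreover have "(\<Sum>x\<in>?E. ?e x) * c + (\<Sum>\<gamma>\<in>?I. int_wt S \<gamma>) * c = c" for c
    using one by (simp add: distrib_right[symmetric])
  ultimately show ?thesis
    unfolding avg[OF p(1)] by (auto simp: case_prod_beta) (smt (verit))+
qed

section \<open>The moving cells during one time step\<close>

text \<open>\<open>J_pos\<close> is (A2); it extends positive orientation, which
  \<open>moving_mesh\<close> states at the time levels, to the times between them.\<close>

locale ale_step =
  fixes S :: "'v ale_dg" and n :: nat
  assumes setting: "ale_setting S" and step: "n < nlev S"
    and J_pos: "\<forall>t\<in>{0..final_time S}. \<forall>K\<in>cells S. 0 < J_at S K t"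
begin

lemma rules: "gauss_rule (pdeg S) (gauss_pt S) (gauss_wt S)" "triangle_rule S" "suitable_bdry S"
  using setting by (auto simp: ale_setting_def)

lemma finite_cells: "finite (cells S)"
  using setting by (auto simp: ale_setting_def moving_mesh_def regular_mesh_def)

lemma tlev_mono: "i \<le> j \<Longrightarrow> j \<le> nlev S \<Longrightarrow> tlev S i \<le> tlev S j"
proof (induction j rule: dec_induct)
  case (step j)
  then have "tlev S j < tlev S (Suc j)"
    using setting by (simp add: ale_setting_def moving_mesh_def)
  with step show ?case by simp
qed simp

lemma dt_pos: "0 < dt S n"
  using setting step by (simp add: ale_setting_def moving_mesh_def dt_def)

lemma slab_in_range: "t \<in> slab S n \<Longrightarrow> t \<in> {0..final_time S}"
proof -
  have "tlev S 0 = 0" using setting by (simp add: ale_setting_def moving_mesh_def)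
  then show "t \<in> slab S n \<Longrightarrow> t \<in> {0..final_time S}"
    using tlev_mono[of 0 n] tlev_mono[of "Suc n" "nlev S"] step
    by (auto simp: slab_def final_time_def)
qed

lemma in_slab: "tlev S n \<in> slab S n" "tlev S (Suc n) \<in> slab S n" "tmid S n \<in> slab S n"
  using dt_pos by (auto simp: slab_def tmid_def dt_def)

lemma det_pos: "t \<in> slab S n \<Longrightarrow> K \<in> cells S \<Longrightarrow> 0 < det (A_at S K t)"
  using J_pos slab_in_range by (auto simp: J_at_def)

lemma area_eq: "t \<in> slab S n \<Longrightarrow> K \<in> cells S \<Longrightarrow> area_at S K t = J_at S K t / 2"
  using det_pos[of t K] by (simp add: area_at_def K_at_def measure_cell_set J_at_def A_at_def)

definition velocity :: "'v \<Rightarrow> real ^ 2" where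
  "velocity v = (1 / dt S n) *\<^sub>R (pos S (tlev S (Suc n)) v - pos S (tlev S n) v)"

lemma vertex_pos:
  assumes "t \<in> slab S n" "K \<in> cells S"
  shows "pos S t (K $ l) = pos S (tlev S n) (K $ l) + (t - tlev S n) *\<^sub>R velocity (K $ l)"
proof -
  have "K $ l \<in> mesh_vertices (cells S)"
    using assms(2) by (auto simp: mesh_vertices_def)
  then have "pos S t (K $ l) = pos S (tlev S n) (K $ l) + ((t - tlev S n) / (tlev S (Suc n) - tlev S n)) *\<^sub>R
      (pos S (tlev S (Suc n)) (K $ l) - pos S (tlev S n) (K $ l))"
    using setting step assms(1) unfolding ale_setting_def moving_mesh_def slab_def by blast
  then show ?thesis by (simp add: velocity_def dt_def)
qed

text \<open>The cell map is linear in the vertex positions, which are affine in time on the slab, so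
  differentiation replaces positions by velocities.\<close>

lemma grid_velocity_eq:
  assumes t: "t \<in> slab S n" and K: "K \<in> cells S"
  shows "grid_velocity S n K \<xi> t = cell_map velocity K \<xi>"
proof -
  have "((\<lambda>s. cell_map (pos S (tlev S n)) K \<xi> + (s - tlev S n) *\<^sub>R cell_map velocity K \<xi>)
      has_vector_derivative cell_map velocity K \<xi>) (at t within slab S n)"
    by (auto intro!: derivative_eq_intros)
  then have "((\<lambda>s. cell_map (pos S s) K \<xi>) has_vector_derivative cell_map velocity K \<xi>)
      (at t within slab S n)"
  proof (rule has_vector_derivative_transform[OF t, rotated])
    show "cell_map (pos S s) K \<xi> =
      cell_map (pos S (tlev S n)) K \<xi> + (s - tlev S n) *\<^sub>R cell_map velocity K \<xi>"
    if "s \<in> slab S n" for s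
    unfolding cell_map_eq vertex_pos[OF that K] by (simp add: algebra_simps)
  qed
  then show ?thesis
    unfolding grid_velocity_def slab_def
    by (rule vector_derivative_within_closed_interval[rotated 2])
      (use t dt_pos in \<open>simp_all add: dt_def slab_def\<close>)
qed

lemma grid_div_eq:
  assumes t: "t \<in> slab S n" and K: "K \<in> cells S"
  shows "grid_div S n K t = trace (matrix_inv (A_at S K t) ** cell_matrix velocity K)"
  unfolding grid_div_def by (rule divergence_matrix_affine) (rule grid_velocity_eq[OF t K])

lemma scaled_cell_normal:
  assumes t: "t \<in> slab S n" and K: "K \<in> cells S"
  shows "ref_length \<nu> *\<^sub>R cell_normal S K \<nu> J t = J *\<^sub>R (transpose (matrix_inv (A_at S K t)) *v
     vector [(ref_vertex (\<nu> + 1) - ref_vertex \<nu>) $ 2, - ((ref_vertex (\<nu> + 1) - ref_vertex \<nu>) $ 1)])"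
  unfolding scaled_ref_normal[symmetric] cell_normal_def
  by (simp add: matrix_vector_mult_scaleR)

text \<open>The edge vectors of the reference triangle close up, and so do their images under a
  rotation and a linear map.\<close>

lemma sum_scaled_cell_normal:
  assumes t: "t \<in> slab S n" and K: "K \<in> cells S"
  shows "(\<Sum>\<nu>\<in>UNIV. ref_length \<nu> *\<^sub>R cell_normal S K \<nu> J t) = 0"
proof -
  define r where "r \<nu> = (vector [(ref_vertex (\<nu> + 1) - ref_vertex \<nu>) $ 2,
      - ((ref_vertex (\<nu> + 1) - ref_vertex \<nu>) $ 1)] :: real ^ 2)" for \<nu>
  have r: "r 1 + r 2 + r 3 = 0"
    by (simp add: r_def four_eq_one_3 ref_vertex_def vec_eq_iff forall_2)
  show ?thesis
    unfolding scaled_cell_normal[OF assms] r_def[symmetric] sum_3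
      scaleR_add_right[symmetric] matrix_vector_right_distrib[symmetric] r by simp
qed

text \<open>The divergence theorem for the affine grid velocity, whose edge integrals the Gauss rule
  evaluates exactly.\<close>

lemma edge_sum_velocity:
  assumes t: "t \<in> slab S n" and K: "K \<in> cells S"
  shows "(\<Sum>\<nu>\<in>UNIV. \<Sum>\<beta>\<in>{1..pdeg S + 1}. gauss_wt S \<beta> * ref_length \<nu> *
      (grid_velocity S n K (edge_node S \<nu> \<beta>) t \<bullet> cell_normal S K \<nu> J t)) = J / 2 * grid_div S n K t"
proof -
  let ?N = "\<lambda>\<nu>. ref_length \<nu> *\<^sub>R cell_normal S K \<nu> J t" and ?V = "\<lambda>\<nu>. velocity (K $ \<nu>)"
  have edge: "(\<Sum>\<beta>\<in>{1..pdeg S + 1}. gauss_wt S \<beta> * ref_length \<nu> *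
      (grid_velocity S n K (edge_node S \<nu> \<beta>) t \<bullet> cell_normal S K \<nu> J t))
      = (?V \<nu> + ?V (\<nu> + 1)) \<bullet> ?N \<nu> / 2" for \<nu>
  proof -
    \<comment> \<open>Along an edge the velocity is the mean of its end values plus
      \<open>gauss_pt S \<beta>\<close> times their difference; the second part has weighted sum
      zero.\<close>
    have "gauss_wt S \<beta> * ref_length \<nu> *
        (grid_velocity S n K (edge_node S \<nu> \<beta>) t \<bullet> cell_normal S K \<nu> J t)
      = gauss_wt S \<beta> * ((?V \<nu> + ?V (\<nu> + 1)) \<bullet> ?N \<nu> / 2)
        + gauss_wt S \<beta> * gauss_pt S \<beta> * ((?V (\<nu> + 1) - ?V \<nu>) \<bullet> ?N \<nu>)" for \<beta>
      by (simp add: grid_velocity_eq[OF assms] edge_node_def cell_map_edge_point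
          inner_add_left inner_diff_left inner_add_right inner_diff_right algebra_simps)
    then show ?thesis
      by (simp only: sum.distrib sum_distrib_right[symmetric] gauss_rule_weight_sum[OF rules(1)]
          gauss_rule_first_moment[OF rules(1)]) simp?
  qed
  show ?thesis
    \<comment> \<open>What remains is bilinear in the entries of the inverse matrix and the vertex
      velocities, so inserting the three reference edges settles it.\<close>
    unfolding edge scaled_cell_normal[OF assms] grid_div_eq[OF assms] matrix_vector_mult_def transpose_def
    by (simp add: sum_3 four_eq_one_3 ref_vertex_def axis_def inner_vec_def sum_2 trace_def
        matrix_matrix_mult_def cell_matrix_def field_simps)
qed
section \<open>The viscosity coefficient\<close>

lemma continuous_on_A_at:
  assumes K: "K \<in> cells S"
  shows "continuous_on (slab S n) (\<lambda>t. A_at S K t $ i $ j)"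
proof -
  have "continuous_on (slab S n) (\<lambda>t. pos S t (K $ l))" for l
  proof (rule continuous_on_eq)
    show "continuous_on (slab S n) (\<lambda>t. pos S (tlev S n) (K $ l) + (t - tlev S n) *\<^sub>R velocity (K $ l))"
      by (intro continuous_intros)
  qed (simp add: vertex_pos[OF _ K, symmetric])
  then show ?thesis
    unfolding A_at_def cell_matrix_def by (cases "j = 1") (auto intro!: continuous_intros)
qed

lemma compact_slab: "compact (slab S n)"
  by (simp add: slab_def)

lemma bounded_step_jacobians:
  assumes K: "K \<in> cells S"
  shows "bounded (\<Union>t\<in>slab S n. step_jacobians S n K t)"
proof -
  have "continuous_on (slab S n) (J_at S K)"
    unfolding J_at_def det_2 by (intro continuous_intros continuous_on_A_at[OF K])
  then have "bounded (J_at S K ` slab S n \<union> {J_1 S n K, J_2 S n K})"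
    using compact_slab by (simp add: compact_imp_bounded compact_continuous_image)
  then show ?thesis
    by (rule bounded_subset) (auto simp: step_jacobians_def split: if_splits)
qed

lemma bounded_cell_normal:
  assumes K: "K \<in> cells S"
  shows "bounded (\<Union>t\<in>slab S n. (\<lambda>J. cell_normal S K \<nu> J t) ` step_jacobians S n K t)"
proof -
  let ?N = "\<lambda>t. transpose (matrix_inv (A_at S K t)) *v ref_normal \<nu>"
  have nz: "det (A_at S K t) \<noteq> 0" if "t \<in> slab S n" for t
    using det_pos[OF that K] by simp
  have cont_det: "continuous_on (slab S n) (\<lambda>t. det (A_at S K t))"
    unfolding det_2 by (intro continuous_intros continuous_on_A_at[OF K])
  have "continuous_on (slab S n) ?N"
  proof (rule continuous_on_eq)
    show "continuous_on (slab S n) (\<lambda>t.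
        ((A_at S K t $ 2 $ 2 * ref_normal \<nu> $ 1 - A_at S K t $ 2 $ 1 * ref_normal \<nu> $ 2) / det (A_at S K t)) *\<^sub>R axis 1 1
        + ((A_at S K t $ 1 $ 1 * ref_normal \<nu> $ 2 - A_at S K t $ 1 $ 2 * ref_normal \<nu> $ 1) / det (A_at S K t)) *\<^sub>R axis 2 1 :: real ^ 2)"
      by (intro continuous_intros continuous_on_A_at[OF K] cont_det ballI nz)
  next
    fix t assume "t \<in> slab S n"
    then show "((A_at S K t $ 2 $ 2 * ref_normal \<nu> $ 1 - A_at S K t $ 2 $ 1 * ref_normal \<nu> $ 2) / det (A_at S K t)) *\<^sub>R axis 1 1
        + ((A_at S K t $ 1 $ 1 * ref_normal \<nu> $ 2 - A_at S K t $ 1 $ 2 * ref_normal \<nu> $ 1) / det (A_at S K t)) *\<^sub>R axis 2 1 = ?N t"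
      by (intro transpose_matrix_inv_mult_2[symmetric] nz)
  qed
  then have "bounded (?N ` slab S n)"
    using compact_slab by (simp add: compact_imp_bounded compact_continuous_image)
  then obtain B where B: "0 < B" "\<And>t. t \<in> slab S n \<Longrightarrow> norm (?N t) \<le> B"
    unfolding bounded_pos by blast
  obtain C where C: "0 < C" "\<And>t J. t \<in> slab S n \<Longrightarrow> J \<in> step_jacobians S n K t \<Longrightarrow> norm J \<le> C"
    using bounded_step_jacobians[OF K] unfolding bounded_pos by blast
  have "norm (cell_normal S K \<nu> J t) \<le> C * B" if "t \<in> slab S n" "J \<in> step_jacobians S n K t" for t J
    unfolding cell_normal_def norm_scaleR
    using B C that by (intro mult_mono) (auto simp: less_imp_le)
  then show ?thesis unfolding bounded_iff by blast
qed

lemma bounded_grid_velocity: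
  assumes K: "K \<in> cells S"
  shows "bounded (\<Union>t\<in>slab S n. (\<lambda>\<xi>. grid_velocity S n K \<xi> t) ` ref_edge \<nu>)"
proof -
  have "continuous_on (ref_edge \<nu>) (cell_map velocity K)"
    unfolding cell_map_eq by (intro continuous_intros)
  moreover have "compact (ref_edge \<nu>)" by (simp add: ref_edge_def)
  ultimately have "bounded (cell_map velocity K ` ref_edge \<nu>)"
    by (simp add: compact_imp_bounded compact_continuous_image)
  then show ?thesis
    by (rule bounded_subset) (auto simp: grid_velocity_eq[OF _ K])
qed

lemma flux_derivative:
  "\<exists>f'. (\<forall>u. (flux S has_vector_derivative f' u) (at u)) \<and> continuous_on UNIV f'"
  using setting unfolding ale_setting_def C1_differentiable_on_def by auto

text \<open>Since \<open>lambda\<close> is a supremum, it dominates the wave speeds only if these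
  are bounded above. States, velocities and normals are bounded by compactness, and Cauchy-Schwarz
  combines them.\<close>

lemma wave_speeds_bounded:
  assumes K: "K \<in> cells S"
  shows "\<exists>B. \<forall>\<xi>\<in>ref_edge \<nu>. \<forall>u\<in>{lo S..hi S}. \<forall>t\<in>slab S n. \<forall>J\<in>step_jacobians S n K t.
     \<bar>vector_derivative (ale_flux S (grid_velocity S n K \<xi> t)) (at u) \<bullet> cell_normal S K \<nu> J t\<bar> \<le> B"
proof -
  obtain f' where f': "\<And>u. (flux S has_vector_derivative f' u) (at u)" and cont: "continuous_on UNIV f'"
    using flux_derivative by blast
  have der: "vector_derivative (ale_flux S \<omega>) (at u) = f' u - \<omega>" for \<omega> u
    unfolding ale_flux_def
    by (rule vector_derivative_at) (auto intro!: derivative_eq_intros f')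
  have "bounded (f' ` {lo S..hi S})"
    using continuous_on_subset[OF cont]
    by (intro compact_imp_bounded compact_continuous_image) auto
  then obtain F where F: "\<And>u. u \<in> {lo S..hi S} \<Longrightarrow> norm (f' u) \<le> F"
    unfolding bounded_iff by blast
  obtain W where W: "\<And>t \<xi>. t \<in> slab S n \<Longrightarrow> \<xi> \<in> ref_edge \<nu> \<Longrightarrow> norm (grid_velocity S n K \<xi> t) \<le> W"
    using bounded_grid_velocity[OF K] unfolding bounded_iff by blast
  obtain N where N: "\<And>t J. t \<in> slab S n \<Longrightarrow> J \<in> step_jacobians S n K t \<Longrightarrow> norm (cell_normal S K \<nu> J t) \<le> N"
    using bounded_cell_normal[OF K] unfolding bounded_iff by blast
  show ?thesis
  proof (intro exI[of _ "(F + W) * N"] ballI)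
    fix \<xi> u t J
    assume *: "\<xi> \<in> ref_edge \<nu>" "u \<in> {lo S..hi S}" "t \<in> slab S n" "J \<in> step_jacobians S n K t"
    let ?d = "f' u - grid_velocity S n K \<xi> t"
    have "norm ?d \<le> F + W"
      using norm_triangle_ineq4[of "f' u" "grid_velocity S n K \<xi> t"] F[OF *(2)] W[OF *(3,1)] by simp
    have "\<bar>?d \<bullet> cell_normal S K \<nu> J t\<bar> \<le> norm ?d * norm (cell_normal S K \<nu> J t)"
      by (rule Cauchy_Schwarz_ineq2)
    also have "\<dots> \<le> (F + W) * N"
      using \<open>norm ?d \<le> F + W\<close> N[OF *(3,4)] by (intro mult_mono) (auto intro: order_trans[OF norm_ge_zero])
    finally show "\<bar>vector_derivative (ale_flux S (grid_velocity S n K \<xi> t)) (at u) \<bullet> cell_normal S K \<nu> J t\<bar>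
        \<le> (F + W) * N"
      unfolding der .
  qed
qed

lemma wave_speed_le_lambda:
  assumes "K \<in> cells S" "\<xi> \<in> ref_edge \<nu>" "u \<in> {lo S..hi S}" "t \<in> slab S n" "J \<in> step_jacobians S n K t"
  shows "\<bar>vector_derivative (ale_flux S (grid_velocity S n K \<xi> t)) (at u) \<bullet> cell_normal S K \<nu> J t\<bar>
    \<le> lambda S n"
proof -
  \<comment> \<open>Splitting by cell and edge leaves a finite union of bounded sets.\<close>
  define X where "X K \<nu> = {\<bar>vector_derivative (ale_flux S (grid_velocity S n K \<xi> t)) (at u) \<bullet> cell_normal S K \<nu> J t\<bar> | \<xi> u t J.
     \<xi> \<in> ref_edge \<nu> \<and> u \<in> {lo S..hi S} \<and> t \<in> slab S n \<and> J \<in> step_jacobians S n K t}" for K \<nu>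
  have "bdd_above (X K \<nu>)" if "K \<in> cells S" for K \<nu>
    using wave_speeds_bounded[OF that, of \<nu>] unfolding X_def bdd_above_def by blast
  then have "bdd_above (\<Union>x\<in>cells S \<times> UNIV. X (fst x) (snd x))"
    using finite_cells by (subst bdd_above_UN) auto
  moreover have "{\<bar>vector_derivative (ale_flux S (grid_velocity S n K \<xi> t)) (at u) \<bullet> cell_normal S K \<nu> J t\<bar> | K \<nu> \<xi> u t J.
     K \<in> cells S \<and> \<xi> \<in> ref_edge \<nu> \<and> u \<in> {lo S..hi S} \<and> t \<in> slab S n \<and> J \<in> step_jacobians S n K t}
     \<subseteq> (\<Union>x\<in>cells S \<times> UNIV. X (fst x) (snd x))" (is "?Y \<subseteq> _")
  proof
    fix y assume "y \<in> ?Y"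
    then obtain K \<nu> where "K \<in> cells S" "y \<in> X K \<nu>"
      unfolding X_def by blast
    then show "y \<in> (\<Union>x\<in>cells S \<times> UNIV. X (fst x) (snd x))" by force
  qed
  ultimately have "bdd_above ?Y" by (rule bdd_above_mono)
  then show ?thesis
    unfolding lambda_def using assms by (intro cSup_upper) blast+
qed

text \<open>The mean value inequality turns the bound on wave speeds into a Lipschitz bound;
  \<open>step_jacobians\<close> lists the normals that \<open>lambda\<close> covers.\<close>

lemma normal_flux_lipschitz:
  assumes "K \<in> cells S" "\<xi> \<in> ref_edge \<nu>" "t \<in> slab S n" "J \<in> step_jacobians S n K t"
    and xy: "lo S \<le> x" "x \<le> y" "y \<le> hi S"
  defines "g \<equiv> \<lambda>u. ale_flux S (grid_velocity S n K \<xi> t) u \<bullet> cell_normal S K \<nu> J t"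
  shows "\<bar>g y - g x\<bar> \<le> lambda S n * (y - x)"
proof -
  let ?\<omega> = "grid_velocity S n K \<xi> t" and ?N = "cell_normal S K \<nu> J t"
  obtain f' where f': "\<And>u. (flux S has_vector_derivative f' u) (at u)"
    using flux_derivative by blast
  have vec: "(ale_flux S ?\<omega> has_vector_derivative f' u - ?\<omega>) (at u)" for u
    unfolding ale_flux_def by (auto intro!: derivative_eq_intros f')
  then have der: "(g has_real_derivative (f' u - ?\<omega>) \<bullet> ?N) (at u)" for u
    unfolding g_def has_real_derivative_iff_has_vector_derivative
    by (rule bounded_linear.has_vector_derivative[OF bounded_linear_inner_left])
  have "\<bar>(f' u - ?\<omega>) \<bullet> ?N\<bar> \<le> lambda S n" if "u \<in> {x..y}" for u
    using wave_speed_le_lambda[OF assms(1,2) _ assms(3,4), of u] that xy vector_derivative_at[OF vec]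
    by simp
  then have "norm (g y - g x) \<le> lambda S n * norm (y - x)"
    using xy der by (intro field_differentiable_bound[of "{x..y}" g "\<lambda>u. (f' u - ?\<omega>) \<bullet> ?N"])
      (auto intro: has_field_derivative_at_within)
  then show ?thesis using xy by simp
qed

end

section \<open>Bounds for one stage\<close>

lemma edge_vertices_distinct:
  assumes "det (cell_matrix P K) \<noteq> 0"
  shows "P (K $ \<nu>) \<noteq> P (K $ (\<nu> + 1))"
proof -
  have "\<forall>\<nu>. P (K $ \<nu>) \<noteq> P (K $ (\<nu> + 1))"
    using assms unfolding forall_3 det_cell_matrix by (auto simp: four_eq_one_3 algebra_simps)
  then show ?thesis by blast
qed

text \<open>Hence two common vertices span an edge of the neighbour, in one of the two
  directions.\<close>

lemma distinct_3_adjacent: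
  fixes l m :: 3
  assumes "l \<noteq> m"
  shows "m = l + 1 \<or> l = m + 1"
proof -
  have "(l = 1 \<or> l = 2 \<or> l = 3) \<and> (m = 1 \<or> m = 2 \<or> m = 3)" using exhaust_3 by blast
  then show ?thesis using assms by (elim conjE disjE; hypsubst; simp add: four_eq_one_3)
qed

text \<open>Formally, the slope in the exterior value is \<open>d * (\<Lambda> - g')\<close> and the
  slope in the interior value is \<open>c - d * (\<Lambda> + g')\<close>, at least
  \<open>c - 2 * d * \<Lambda>\<close>; both are nonnegative.\<close>

lemma lax_friedrichs_mono:
  fixes g :: "real \<Rightarrow> real"
  assumes lip: "\<And>x y. l \<le> x \<Longrightarrow> x \<le> y \<Longrightarrow> y \<le> h \<Longrightarrow> \<bar>g y - g x\<bar> \<le> \<Lambda> * (y - x)"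
    and "0 \<le> d" "2 * d * \<Lambda> \<le> c"
    and "l \<le> a" "a \<le> a'" "a' \<le> h" "l \<le> b" "b \<le> b'" "b' \<le> h"
  shows "c * a - 2 * d * (1/2 * (\<Lambda> * a + g a) - 1/2 * (\<Lambda> * b - g b))
    \<le> c * a' - 2 * d * (1/2 * (\<Lambda> * a' + g a') - 1/2 * (\<Lambda> * b' - g b'))"
proof -
  have "(g a' - g a) + (g b' - g b) \<le> \<Lambda> * (a' - a) + \<Lambda> * (b' - b)"
    using lip[of a a'] lip[of b b'] assms(4-9) by linarith
  then have "d * (\<Lambda> * (a' - a) + (g a' - g a) - \<Lambda> * (b' - b) + (g b' - g b)) \<le> d * (2 * (\<Lambda> * (a' - a)))"
    using \<open>0 \<le> d\<close> by (intro mult_left_mono) auto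
  also have "\<dots> = 2 * d * \<Lambda> * (a' - a)" by simp
  also have "\<dots> \<le> c * (a' - a)" using assms by (intro mult_right_mono) auto
  finally show ?thesis by (simp add: algebra_simps)
qed

context ale_step
begin

text \<open>The limiter controls nodal values only. On an interior edge the exterior value is itself
  a nodal value of the neighbour, because the Gauss nodes are symmetric.\<close>

lemma ext_value_bounds:
  assumes t: "t \<in> slab S n" and K: "K \<in> cells S" and \<beta>: "\<beta> \<in> {1..pdeg S + 1}"
    and w: "\<And>K. K \<in> cells S \<Longrightarrow> w K \<in> Pk S"
    and bnd: "\<And>K \<xi>. K \<in> cells S \<Longrightarrow> \<xi> \<in> quad_nodes S \<Longrightarrow> w K \<xi> \<in> {lo S..hi S}"
  shows "ext_value S w t K \<nu> \<beta> \<in> {lo S..hi S}"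
proof (cases "neighbours (cells S) K \<nu> = {}")
  case True
  then show ?thesis
    using rules(3) slab_in_range[OF t] K \<beta> w bnd unfolding suitable_bdry_def ext_value_def
    by simp
next
  case False
  define K' where "K' = (SOME K'. K' \<in> neighbours (cells S) K \<nu>)"
  have "K' \<in> neighbours (cells S) K \<nu>"
    using False unfolding K'_def by (simp add: some_in_eq)
  then have K': "K' \<in> cells S" and "K $ \<nu> \<in> range (($) K')" "K $ (\<nu> + 1) \<in> range (($) K')"
    by (auto simp: neighbours_def)
  then obtain l m where lm: "K $ \<nu> = K' $ l" "K $ (\<nu> + 1) = K' $ m" by blast
  have det: "det (cell_matrix (pos S t) K) \<noteq> 0" "det (cell_matrix (pos S t) K') \<noteq> 0"
    using det_pos[OF t K] det_pos[OF t K'] by (simp_all add: A_at_def)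
  have "l \<noteq> m" using edge_vertices_distinct[OF det(1), of \<nu>] lm by auto
  then consider "m = l + 1" | "l = m + 1" using distinct_3_adjacent by blast
  then obtain \<nu>' \<beta>' where "\<beta>' \<in> {1..pdeg S + 1}"
    and eq: "cell_map (pos S t) K (edge_node S \<nu> \<beta>) = cell_map (pos S t) K' (edge_node S \<nu>' \<beta>')"
  proof cases
    case 1
    then show ?thesis
      using that[OF \<beta>, of l] lm by (simp add: edge_node_def cell_map_edge_point)
  next
    \<comment> \<open>The neighbour traverses the edge in the opposite direction, so the parameter
      changes sign.\<close>
    case 2
    obtain \<beta>' where "\<beta>' \<in> {1..pdeg S + 1}" "gauss_pt S \<beta>' = - gauss_pt S \<beta>"
      using gauss_rule_symmetric[OF rules(1) \<beta>] by blast
    then show ?thesis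
      using that[of \<beta>' m] lm 2 by (simp add: edge_node_def cell_map_edge_point add.commute)
  qed
  have "ext_value S w t K \<nu> \<beta> = w K' (edge_node S \<nu>' \<beta>')"
    using False by (simp add: ext_value_def K'_def[symmetric] eq cell_map_inv_cell_map[OF det(2)])
  then show ?thesis
    using bnd[OF K' edge_node_in_quad_nodes[OF \<open>\<beta>' \<in> _\<close>]] by simp
qed

text \<open>The physical flux of a constant drops out as the weighted normals sum to zero; the grid
  velocity contributes its divergence.\<close>

lemma const_flux_sum:
  assumes t: "t \<in> slab S n" and K: "K \<in> cells S"
  shows "(\<Sum>\<nu>\<in>UNIV. \<Sum>\<beta>\<in>{1..pdeg S + 1}. gauss_wt S \<beta> * ref_length \<nu> *
      (ale_flux S (grid_velocity S n K (edge_node S \<nu> \<beta>) t) c \<bullet> cell_normal S K \<nu> J t))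
    = - c * (J / 2 * grid_div S n K t)"
proof -
  let ?N = "\<lambda>\<nu>. cell_normal S K \<nu> J t" and ?\<omega> = "\<lambda>\<nu> \<beta>. grid_velocity S n K (edge_node S \<nu> \<beta>) t"
  have "gauss_wt S \<beta> * ref_length \<nu> * (ale_flux S (?\<omega> \<nu> \<beta>) c \<bullet> ?N \<nu>)
    = gauss_wt S \<beta> * (flux S c \<bullet> (ref_length \<nu> *\<^sub>R ?N \<nu>))
      - c * (gauss_wt S \<beta> * ref_length \<nu> * (?\<omega> \<nu> \<beta> \<bullet> ?N \<nu>))" for \<nu> \<beta>
    by (simp add: ale_flux_def inner_diff_left algebra_simps)
  then have "(\<Sum>\<nu>\<in>UNIV. \<Sum>\<beta>\<in>{1..pdeg S + 1}. gauss_wt S \<beta> * ref_length \<nu> *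
      (ale_flux S (?\<omega> \<nu> \<beta>) c \<bullet> ?N \<nu>))
    = (\<Sum>\<nu>\<in>UNIV. flux S c \<bullet> (ref_length \<nu> *\<^sub>R ?N \<nu>)) - c * (J / 2 * grid_div S n K t)"
    by (simp only: sum_subtractf sum_distrib_left[symmetric] sum_distrib_right[symmetric]
        gauss_rule_weight_sum[OF rules(1)] edge_sum_velocity[OF assms] mult_1)
  also have "(\<Sum>\<nu>\<in>UNIV. flux S c \<bullet> (ref_length \<nu> *\<^sub>R ?N \<nu>)) = 0"
    unfolding inner_sum_right[symmetric] sum_scaled_cell_normal[OF assms] by simp
  finally show ?thesis by simp
qed

lemma dg_op_one:
  "dg_op S n K w (\<lambda>_. 1) J t = - (\<Sum>\<nu>\<in>UNIV. \<Sum>\<beta>\<in>{1..pdeg S + 1}. gauss_wt S \<beta> * ref_length \<nu> *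
     lf_flux S n (grid_velocity S n K (edge_node S \<nu> \<beta>) t)
       (int_value S w K \<nu> \<beta>) (ext_value S w t K \<nu> \<beta>) (cell_normal S K \<nu> J t))"
  unfolding dg_op_def by (simp add: gradient_const)

text \<open>The factor of the bounds is the Jacobian of the next stage, by the discrete geometric
  conservation law.\<close>

lemma stage_average_bounds:
  assumes t: "t \<in> slab S n" and K: "K \<in> cells S" and J: "J \<in> step_jacobians S n K t" "0 \<le> J"
    and p: "w K \<in> Pk S" "\<And>\<xi>. \<xi> \<in> quad_nodes S \<Longrightarrow> w K \<xi> \<in> {lo S..hi S}"
    and ext_bnd: "\<And>\<nu> \<beta>. \<beta> \<in> {1..pdeg S + 1} \<Longrightarrow> ext_value S w t K \<nu> \<beta> \<in> {lo S..hi S}"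
    and d: "0 \<le> d" "\<And>\<nu>. 2 * d * ref_length \<nu> * lambda S n \<le> sigma_hat S * J"
  shows "J * cell_average (w K) + 2 * d * dg_op S n K w (\<lambda>_. 1) J t
    \<in> {lo S * (J + d * grid_div S n K t * J)..hi S * (J + d * grid_div S n K t * J)}"
proof -
  \<comment> \<open>Each edge node's share of the average is paired with the flux through the same
    node, so monotonicity can be checked node by node.\<close>
  define E where "E a b = (\<Sum>\<nu>\<in>UNIV. \<Sum>\<beta>\<in>{1..pdeg S + 1}. gauss_wt S \<beta> * (sigma_hat S * J * a \<nu> \<beta>
    - 2 * (d * ref_length \<nu>) * lf_flux S n (grid_velocity S n K (edge_node S \<nu> \<beta>) t) (a \<nu> \<beta>) (b \<nu> \<beta>)
        (cell_normal S K \<nu> J t)))" for a b :: "3 \<Rightarrow> nat \<Rightarrow> real"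
  define I where "I q = (\<Sum>\<gamma>\<in>{1..num_int S}. int_wt S \<gamma> * q (int_pt S \<gamma>))" for q
  let ?a = "int_value S w K" and ?b = "ext_value S w t K"
  have split: "J * cell_average q - 2 * d * (\<Sum>\<nu>\<in>UNIV. \<Sum>\<beta>\<in>{1..pdeg S + 1}. gauss_wt S \<beta> * ref_length \<nu> *
       lf_flux S n (grid_velocity S n K (edge_node S \<nu> \<beta>) t) (q (edge_node S \<nu> \<beta>)) (b \<nu> \<beta>)
         (cell_normal S K \<nu> J t))
    = E (\<lambda>\<nu> \<beta>. q (edge_node S \<nu> \<beta>)) b + J * I q" if "q \<in> Pk S" for q b
    unfolding quadrature_eq[OF rules(2) that] E_def I_def
    by (simp add: sum_distrib_left right_diff_distrib sum_subtractf distrib_left mult_ac del: sum.cl_ivl_Suc)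
  \<comment> \<open>For equal states the viscosity terms cancel, leaving the flux sum of a
    constant.\<close>
  have const: "E (\<lambda>_ _. c) (\<lambda>_ _. c) + J * I (\<lambda>_. c) = c * (J + d * grid_div S n K t * J)" for c
    using split[of "\<lambda>_. c" "\<lambda>_ _. c", symmetric] const_in_P_space[of c "pdeg S"] const_flux_sum[OF t K, of c J]
    by (simp add: Pk_def cell_average_const lf_flux_def algebra_simps del: sum.cl_ivl_Suc)
  have mono_E: "E a b \<le> E a' b'"
    if "\<And>\<nu> \<beta>. \<beta> \<in> {1..pdeg S + 1} \<Longrightarrow> lo S \<le> a \<nu> \<beta> \<and> a \<nu> \<beta> \<le> a' \<nu> \<beta> \<and> a' \<nu> \<beta> \<le> hi S"
      "\<And>\<nu> \<beta>. \<beta> \<in> {1..pdeg S + 1} \<Longrightarrow> lo S \<le> b \<nu> \<beta> \<and> b \<nu> \<beta> \<le> b' \<nu> \<beta> \<and> b' \<nu> \<beta> \<le> hi S"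
    for a b a' b'
    unfolding E_def
  proof (intro sum_mono mult_left_mono)
    fix \<nu> \<beta> assume \<beta>: "\<beta> \<in> {1..pdeg S + 1}"
    show "0 \<le> gauss_wt S \<beta>" using gauss_wt_pos[OF rules(2) \<beta>] by simp
    have "edge_node S \<nu> \<beta> \<in> ref_edge \<nu>"
      unfolding edge_node_def using rules(1) \<beta> unfolding gauss_rule_def
      by (intro edge_point_in_ref_edge) blast
    then show "sigma_hat S * J * a \<nu> \<beta> - 2 * (d * ref_length \<nu>) *
        lf_flux S n (grid_velocity S n K (edge_node S \<nu> \<beta>) t) (a \<nu> \<beta>) (b \<nu> \<beta>) (cell_normal S K \<nu> J t)
      \<le> sigma_hat S * J * a' \<nu> \<beta> - 2 * (d * ref_length \<nu>) *
        lf_flux S n (grid_velocity S n K (edge_node S \<nu> \<beta>) t) (a' \<nu> \<beta>) (b' \<nu> \<beta>) (cell_normal S K \<nu> J t)"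
      unfolding lf_flux_def
      using that(1)[OF \<beta>, of \<nu>] that(2)[OF \<beta>, of \<nu>] d(1) d(2)[of \<nu>] ref_length_pos[of \<nu>]
      by (intro lax_friedrichs_mono[where l = "lo S" and h = "hi S"
            and g = "\<lambda>u. ale_flux S (grid_velocity S n K (edge_node S \<nu> \<beta>) t) u \<bullet> cell_normal S K \<nu> J t"]
          normal_flux_lipschitz K t J) (auto simp: mult.assoc)
  qed
  have I: "J * I q \<le> J * I q'" if "\<And>\<gamma>. \<gamma> \<in> {1..num_int S} \<Longrightarrow> q (int_pt S \<gamma>) \<le> q' (int_pt S \<gamma>)" for q q'
    unfolding I_def using that J(2) int_wt_pos[OF rules(2)]
    by (intro mult_left_mono sum_mono) (auto simp: less_imp_le simp del: One_nat_def)
  have a: "lo S \<le> ?a \<nu> \<beta> \<and> ?a \<nu> \<beta> \<le> hi S" if "\<beta> \<in> {1..pdeg S + 1}" for \<nu> \<beta>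
    using p(2)[OF edge_node_in_quad_nodes[OF that]] by (simp add: int_value_def)
  have b: "lo S \<le> ?b \<nu> \<beta> \<and> ?b \<nu> \<beta> \<le> hi S" if "\<beta> \<in> {1..pdeg S + 1}" for \<nu> \<beta>
    using ext_bnd[OF that] by simp
  have lohi: "lo S \<le> hi S" using a[of 1 1] by simp
  have ends: "lo S \<le> w K (int_pt S \<gamma>)" "w K (int_pt S \<gamma>) \<le> hi S" if "\<gamma> \<in> {1..num_int S}" for \<gamma>
    using p(2)[OF int_pt_in_quad_nodes[OF that]] by simp_all
  have "J * cell_average (w K) + 2 * d * dg_op S n K w (\<lambda>_. 1) J t = E ?a ?b + J * I (w K)"
  proof -
    have "?a = (\<lambda>\<nu> \<beta>. w K (edge_node S \<nu> \<beta>))"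
      by (intro ext) (simp add: int_value_def)
    then show ?thesis using split[OF p(1), of ?b] by (simp add: dg_op_one del: sum.cl_ivl_Suc)
  qed
  moreover have "E ?a ?b + J * I (w K) \<le> E (\<lambda>_ _. hi S) (\<lambda>_ _. hi S) + J * I (\<lambda>_. hi S)"
    using a b ends lohi by (intro add_mono mono_E I) auto
  moreover have "E (\<lambda>_ _. lo S) (\<lambda>_ _. lo S) + J * I (\<lambda>_. lo S) \<le> E ?a ?b + J * I (w K)"
    using a b ends lohi by (intro add_mono mono_E I) auto
  ultimately show ?thesis unfolding const by simp
qed

text \<open>A supremum of absolute values is nonnegative once it has an element below it;
  \<open>lo S \<le> hi S\<close> supplies an admissible state.\<close>

lemma lambda_nonneg:
  assumes "K \<in> cells S" "lo S \<le> hi S"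
  shows "0 \<le> lambda S n"
  using wave_speed_le_lambda[OF assms(1), of "ref_vertex 1" 1 "lo S" "tlev S n" "J_at S K (tlev S n)"]
    in_slab(1) assms(2)
  by (auto simp: ref_edge_def step_jacobians_def intro: order_trans[OF abs_ge_zero])

text \<open>Continuity makes the supremum in the CFL condition one over a bounded set.\<close>

lemma continuous_on_grid_div:
  assumes K: "K \<in> cells S"
  shows "continuous_on (slab S n) (grid_div S n K)"
proof -
  have nz: "det (A_at S K t) \<noteq> 0" if "t \<in> slab S n" for t
    using det_pos[OF that K] by simp
  have cont_det: "continuous_on (slab S n) (\<lambda>t. det (A_at S K t))"
    unfolding det_2 by (intro continuous_intros continuous_on_A_at[OF K])
  let ?B = "cell_matrix velocity K"
  show ?thesis
  proof (rule continuous_on_eq)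
    show "continuous_on (slab S n) (\<lambda>t. (A_at S K t $ 2 $ 2 * ?B $ 1 $ 1 - A_at S K t $ 1 $ 2 * ?B $ 2 $ 1
        - A_at S K t $ 2 $ 1 * ?B $ 1 $ 2 + A_at S K t $ 1 $ 1 * ?B $ 2 $ 2) / det (A_at S K t))"
      by (intro continuous_intros continuous_on_A_at[OF K] cont_det ballI nz)
  next
    fix t assume t: "t \<in> slab S n"
    show "(A_at S K t $ 2 $ 2 * ?B $ 1 $ 1 - A_at S K t $ 1 $ 2 * ?B $ 2 $ 1
        - A_at S K t $ 2 $ 1 * ?B $ 1 $ 2 + A_at S K t $ 1 $ 1 * ?B $ 2 $ 2) / det (A_at S K t)
      = grid_div S n K t"
      unfolding grid_div_eq[OF t K] matrix_inv_2[OF nz[OF t]]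
      by (simp add: trace_def matrix_matrix_mult_def sum_2 add_divide_distrib diff_divide_distrib)
  qed
qed

end

section \<open>The CFL condition\<close>

lemma quad_node_bounds:
  assumes "\<forall>\<gamma>\<in>{1..num_int S}. w K (int_pt S \<gamma>) \<in> {lo S..hi S}" "int_value S w K \<in> edge_box S"
    and "\<xi> \<in> quad_nodes S"
  shows "w K \<xi> \<in> {lo S..hi S}"
  using assms unfolding quad_nodes_def edge_box_def int_value_def by blast

text \<open>With \<open>x\<close> the edge part of the CFL bound, \<open>\<Delta>t \<bar>g\<bar> a \<le> y - x\<close> and \<open>y < a\<close> give
  \<open>a\<^sub>1 \<ge> x\<close>, \<open>1 + \<Delta>t g \<ge> x / y\<close> and hence \<open>a\<^sub>2 \<ge> 3 y / 4 + x\<^sup>2 / (4 y) \<ge> x\<close>.\<close>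

lemma stage_areas:
  fixes y x d :: real
  assumes x: "0 \<le> x" and y: "y < a0" "y < ae" "y < am" "0 < y" and d: "0 < d"
    and g: "d * \<bar>g0\<bar> * a0 \<le> y - x" "d * \<bar>ge\<bar> * ae \<le> y - x" "d * \<bar>gm\<bar> * am \<le> y - x"
    and a1: "a1 = a0 + d * g0 * a0"
    and a2: "a2 = 3/4 * a0 + 1/4 * a1 + d / 4 * ge * a1"
    and a3: "a3 = 1/3 * a0 + 2/3 * a2 + 2 * d / 3 * gm * a2"
  shows "0 < a1" "x \<le> a1" "0 < a2" "x \<le> a2" "0 < a3" "x \<le> a0"
proof -
  \<comment> \<open>As \<open>y < a\<close>, the bound on \<open>d * \<bar>g\<bar> * a\<close> also
    holds with \<open>y\<close> in place of \<open>a\<close>, which removes the dependence on the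
    time.\<close>
  have factor: "x / y \<le> 1 + d * g" if "y < a" "d * \<bar>g\<bar> * a \<le> y - x" for a g
  proof -
    have "d * \<bar>g\<bar> * y \<le> d * \<bar>g\<bar> * a" using that(1) d by (intro mult_left_mono) auto
    then have "d * \<bar>g\<bar> * y \<le> y - x" using that(2) by simp
    moreover have "- (d * \<bar>g\<bar>) \<le> d * g" using d by (auto simp: abs_if)
    then have "- (d * \<bar>g\<bar>) * y \<le> d * g * y" using y by (intro mult_right_mono) auto
    ultimately show ?thesis using y by (simp add: pos_divide_le_eq distrib_right)
  qed
  have xy: "x \<le> y" using g(1) d y by (smt (verit) mult_nonneg_nonneg abs_ge_zero)
  then show "x \<le> a0" using y by simp
  have "- (d * \<bar>g0\<bar> * a0) \<le> d * g0 * a0"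
    using d y by (auto simp: abs_if)
  then show a1x: "x \<le> a1" and a1p: "0 < a1" using a1 g(1) x y by auto
  have "x * (x / y) \<le> a1 * (1 + d * ge)"
    using factor[OF y(2) g(2)] a1x a1p x y by (intro mult_mono) auto
  then have a2l: "3/4 * a0 + 1/4 * (x * (x / y)) \<le> a2"
    unfolding a2 by (simp add: algebra_simps)
  have "0 \<le> x * (x / y)" using x y by simp
  then show a2p: "0 < a2" using a2l y by linarith
  \<comment> \<open>This is the desired inequality between \<open>x\<close> and
    \<open>3/4 * y + 1/4 * (x * (x / y))\<close> multiplied by \<open>4 * y\<close>.\<close>
  have "0 \<le> (3 * y - x) * (y - x)" using xy y by simp
  then have "4 * x * y \<le> 3 * y * y + x * x" by (simp add: algebra_simps)
  then have "x \<le> 3/4 * y + 1/4 * (x * (x / y))" using y by (simp add: field_simps)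
  then show "x \<le> a2" using a2l y by linarith
  \<comment> \<open>For the last area positivity is enough, since no further flux step starts from
    it.\<close>
  have "0 \<le> a2 * (1 + d * gm)"
    using factor[OF y(3) g(3)] a2p x y by (intro mult_nonneg_nonneg) (auto intro: order_trans[rotated])
  then show "0 < a3" unfolding a3 using y by (simp add: algebra_simps)
qed

lemma inner_ref_one: "inner_ref w (\<lambda>_. 1) = cell_average w / 2"
  by (simp add: inner_ref_def cell_average_def measure_K_ref)

lemma in_bounds_of_mult:
  fixes J a :: real
  assumes "0 < J" "J * a \<in> {l * J..h * J}"
  shows "a \<in> {l..h}"
  using assms by (simp add: mult.commute)

context ale_step
begin

text \<open>By (A3), \<open>h_max\<close> is at most \<tau> \<kappa> times the inball radius, whose
  square is at most a ninth of the Jacobian, while the area is half of it.\<close>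

lemma h_max_pos_area_bound:
  assumes A1: "\<forall>t\<in>{0..final_time S}. closure (Omega S) = (\<Union>K\<in>cells S. closure (K_at S K t))"
    and A3: "0 < \<kappa>" "0 < \<tau>" "\<forall>t\<in>{0..final_time S}. \<forall>K\<in>cells S.
         h_at S K t \<le> \<kappa> * rho_at S K t \<and> h_max S \<le> \<tau> * h_at S K t"
    and t: "t \<in> slab S n" and K: "K \<in> cells S"
  shows "0 < h_max S" "pi * (h_max S)\<^sup>2 / (\<tau>\<^sup>2 * \<kappa>\<^sup>2) < area_at S K t"
proof -
  have T: "t \<in> {0..final_time S}" by (rule slab_in_range[OF t])
  have "bounded (closure (Omega S))"
    using setting by (simp add: ale_setting_def polytope_imp_bounded)
  \<comment> \<open>By (A1) every cell lies in the bounded closure of the domain, so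
    \<open>h_max\<close> is a supremum over a bounded set.\<close>
  then have "h_at S K' s \<le> diameter (closure (Omega S))"
    if "K' \<in> cells S" "s \<in> {0..final_time S}" for K' s
    unfolding h_at_def using A1 that closure_subset by (intro diameter_subset) blast+
  then have "bdd_above ((\<lambda>(K, t). h_at S K t) ` (cells S \<times> {0..final_time S}))"
    by (intro bdd_aboveI2[where M = "diameter (closure (Omega S))"]) auto
  then have "h_at S K t \<le> h_max S"
    unfolding h_max_def using cSUP_upper[of "(K, t)" "cells S \<times> {0..final_time S}" "\<lambda>(K, t). h_at S K t"] K T by simp
  moreover have "0 < h_at S K t"
    unfolding h_at_def K_at_def using det_pos[OF t K] by (intro diameter_cell_set_pos) (simp add: A_at_def)
  ultimately show h: "0 < h_max S" by simp
  have "rho_at S K t \<le> sqrt (J_at S K t) / 3"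
    unfolding rho_at_def K_at_def J_at_def A_at_def
    using det_pos[OF t K] by (intro inball_radius_le) (simp add: A_at_def)
  moreover have "h_max S \<le> \<tau> * (\<kappa> * rho_at S K t)"
    using A3 T K by (meson mult_left_mono less_imp_le order_trans)
  ultimately have "h_max S \<le> \<tau> * (\<kappa> * (sqrt (J_at S K t) / 3))"
    using A3(1,2) by (meson mult_left_mono less_imp_le order_trans)
  then have "(h_max S)\<^sup>2 \<le> (\<tau> * (\<kappa> * (sqrt (J_at S K t) / 3)))\<^sup>2"
    using h by (intro power_mono) auto
  also have "\<dots> = \<tau>\<^sup>2 * \<kappa>\<^sup>2 * (J_at S K t / 9)"
    using det_pos[OF t K] by (simp add: power_mult_distrib power_divide J_at_def)
  finally have "(h_max S)\<^sup>2 / (\<tau>\<^sup>2 * \<kappa>\<^sup>2) \<le> J_at S K t / 9"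
    using A3(1,2) by (simp add: divide_le_eq mult.commute)
  then have "pi * ((h_max S)\<^sup>2 / (\<tau>\<^sup>2 * \<kappa>\<^sup>2)) \<le> pi * (J_at S K t / 9)"
    by (intro mult_left_mono) auto
  also have "\<dots> < J_at S K t / 2"
  proof -
    \<comment> \<open>The crude bound suffices because 4/9 < 1/2.\<close>
    have "pi * J_at S K t < 4 * J_at S K t"
      using pi_less_4 det_pos[OF t K] by (intro mult_strict_right_mono) (auto simp: J_at_def)
    then show ?thesis using det_pos[OF t K] by (simp add: J_at_def)
  qed
  finally show "pi * (h_max S)\<^sup>2 / (\<tau>\<^sup>2 * \<kappa>\<^sup>2) < area_at S K t"
    by (simp add: area_eq[OF t K])
qed

lemma CFL_at:
  assumes h: "0 < h_max S" and K: "K \<in> cells S" and t: "t \<in> slab S n"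
    and CFL: "(SUP t\<in>slab S n. sigma_hat S * \<bar>grid_div S n K t\<bar> * area_at S K t + L)
      * (dt S n / (h_max S)\<^sup>2) \<le> sigma_hat S * c"
  shows "dt S n * \<bar>grid_div S n K t\<bar> * area_at S K t \<le> c * (h_max S)\<^sup>2 - dt S n * L / sigma_hat S"
proof -
  let ?f = "\<lambda>t. sigma_hat S * \<bar>grid_div S n K t\<bar> * area_at S K t + L"
  have "continuous_on (slab S n) (\<lambda>t. sigma_hat S * \<bar>grid_div S n K t\<bar> * (det (A_at S K t) / 2) + L)"
    unfolding det_2 by (intro continuous_intros continuous_on_grid_div[OF K] continuous_on_A_at[OF K]) auto
  then have "continuous_on (slab S n) ?f"
    by (rule continuous_on_eq) (simp add: area_eq[OF _ K] J_at_def)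
  then have "bdd_above (?f ` slab S n)"
    using compact_slab by (intro bounded_imp_bdd_above compact_imp_bounded compact_continuous_image)
  then have "?f t \<le> (SUP t\<in>slab S n. ?f t)"
    using t by (intro cSUP_upper)
  then have "?f t * (dt S n / (h_max S)\<^sup>2) \<le> (SUP t\<in>slab S n. ?f t) * (dt S n / (h_max S)\<^sup>2)"
    using dt_pos h by (intro mult_right_mono) auto
  also note CFL
  finally have "?f t * dt S n \<le> sigma_hat S * (c * (h_max S)\<^sup>2)"
    using h by (simp add: divide_le_eq mult.assoc)
  then show ?thesis
    using sigma_hat_pos[of S] by (simp add: field_simps)
qed

end

section \<open>The three Runge-Kutta stages with limiting\<close>

theorem theorem4p9:
  fixes S :: "'v ale_dg" and n :: nat and \<kappa> \<tau> :: real
    and u w1 w2 w3 :: "'v ^ 3 \<Rightarrow> real ^ 2 \<Rightarrow> real"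
  assumes setting: "ale_setting S" and step: "n < nlev S"
    and A1: "\<forall>t\<in>{0..final_time S}. closure (Omega S) = (\<Union>K\<in>cells S. closure (K_at S K t))"
    and A2: "\<forall>t\<in>{0..final_time S}. \<forall>K\<in>cells S. 0 < J_at S K t"
    and A3: "0 < \<kappa>" "0 < \<tau>"
      "\<forall>t\<in>{0..final_time S}. \<forall>K\<in>cells S.
         h_at S K t \<le> \<kappa> * rho_at S K t \<and> h_max S \<le> \<tau> * h_at S K t"
    and poly: "\<forall>K\<in>cells S. u K \<in> Pk S"
    and bound_interior: "\<forall>K\<in>cells S. \<forall>\<gamma>\<in>{1..num_int S}. u K (int_pt S \<gamma>) \<in> {lo S..hi S}"
    and bound_int: "\<forall>K\<in>cells S. int_value S u K \<in> edge_box S"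
    and bound_ext: "\<forall>K\<in>cells S. ext_value S u (tlev S n) K \<in> edge_box S"
    and CFL: "\<forall>K\<in>cells S.
      (SUP t\<in>slab S n. sigma_hat S * \<bar>grid_div S n K t\<bar> * area_at S K t
                        + (\<Sum>\<nu>\<in>UNIV. lambda S n * ref_length \<nu>)) * (dt S n / (h_max S)\<^sup>2)
        \<le> pi * sigma_hat S / (\<tau>\<^sup>2 * \<kappa>\<^sup>2)"
    and stage1: "\<forall>K\<in>cells S. w1 K \<in> Pk S \<and> (\<forall>v\<in>Pk S.
      J_1 S n K * inner_ref (w1 K) v =
        J_0 S n K * inner_ref (u K) v
        + dt S n * dg_op S n K u v (J_0 S n K) (tlev S n))"
    and stage2: "\<forall>K\<in>cells S. w2 K \<in> Pk S \<and> (\<forall>v\<in>Pk S.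
      J_2 S n K * inner_ref (w2 K) v =
        3/4 * J_0 S n K * inner_ref (u K) v
        + 1/4 * J_1 S n K * inner_ref (revised S w1 K) v
        + dt S n / 4 * dg_op S n K (revised S w1) v (J_1 S n K) (tlev S (Suc n)))"
    and stage3: "\<forall>K\<in>cells S. w3 K \<in> Pk S \<and> (\<forall>v\<in>Pk S.
      J_3 S n K * inner_ref (w3 K) v =
        1/3 * J_0 S n K * inner_ref (u K) v
        + 2/3 * J_2 S n K * inner_ref (revised S w2 K) v
        + 2 * dt S n / 3 * dg_op S n K (revised S w2) v (J_2 S n K) (tmid S n))"
  shows "\<forall>K\<in>cells S. \<forall>\<xi>\<in>quad_nodes S. revised S w3 K \<xi> \<in> {lo S..hi S}"
proof -
  interpret ale_step S n
    using setting step A2 by unfold_locales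
  \<comment> \<open>All cell areas in the slab exceed \<open>y\<close>; \<open>x\<close> is the area
    for which the factor \<open>sigma_hat S\<close> balances the flux through all three
    edges.\<close>
  define y where "y = pi * (h_max S)\<^sup>2 / (\<tau>\<^sup>2 * \<kappa>\<^sup>2)"
  define x where "x = dt S n * (\<Sum>\<nu>\<in>UNIV. lambda S n * ref_length \<nu>) / sigma_hat S"
  have one: "(\<lambda>_. 1) \<in> Pk S" by (simp add: Pk_def const_in_P_space)
  have u_bounds: "u K \<xi> \<in> {lo S..hi S}" if "K \<in> cells S" "\<xi> \<in> quad_nodes S" for K \<xi>
    using quad_node_bounds[of S u K \<xi>] bound_interior bound_int that by blast
  have bounds: "lo S \<le> hi S" if "K \<in> cells S" for K
    using u_bounds[OF that edge_node_in_quad_nodes[of 1]] by fastforce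
  have lam: "0 \<le> lambda S n" if "K \<in> cells S" for K
    using lambda_nonneg[OF that bounds[OF that]] .
  have x: "0 \<le> x" if "K \<in> cells S" for K
    unfolding x_def using lam[OF that] dt_pos sigma_hat_pos[of S]
    by (simp add: sum_nonneg less_imp_le ref_length_pos)
  have y: "y < area_at S K t" "0 < y" if "K \<in> cells S" "t \<in> slab S n" for K t
    using h_max_pos_area_bound[OF A1 A3 that(2,1)] A3(1,2) by (simp_all add: y_def)
  have cfl: "dt S n * \<bar>grid_div S n K t\<bar> * area_at S K t \<le> y - x"
    if "K \<in> cells S" "t \<in> slab S n" for K t
    using CFL_at[OF h_max_pos_area_bound(1)[OF A1 A3 that(2,1)] that,
        of "\<Sum>\<nu>\<in>UNIV. lambda S n * ref_length \<nu>" "pi / (\<tau>\<^sup>2 * \<kappa>\<^sup>2)"] CFL that(1)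
    by (simp add: x_def y_def mult.commute)
  \<comment> \<open>The CFL bound involves exact cell areas at the three stage times; it is
    transferred here to the Runge-Kutta stage areas.\<close>
  have areas: "0 < area_1 S n K" "x \<le> area_1 S n K" "0 < area_2 S n K" "x \<le> area_2 S n K"
      "0 < area_3 S n K" "x \<le> area_0 S n K" if K: "K \<in> cells S" for K
    using stage_areas[OF x[OF K] y(1)[OF K in_slab(1), folded area_0_def] y(1)[OF K in_slab(2)]
        y(1)[OF K in_slab(3)] y(2)[OF K in_slab(1)] dt_pos cfl[OF K in_slab(1), folded area_0_def]
        cfl[OF K in_slab(2)] cfl[OF K in_slab(3)] area_1_def area_2_def area_3_def]
    by blast+
  have stage: "2 * A * cell_average (w K) + 2 * dt S n * dg_op S n K w (\<lambda>_. 1) (2 * A) t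
      \<in> {lo S * (2 * A + dt S n * grid_div S n K t * (2 * A))..hi S * (2 * A + dt S n * grid_div S n K t * (2 * A))}"
    if K: "K \<in> cells S" and t: "t \<in> slab S n" and A: "2 * A \<in> step_jacobians S n K t" "x \<le> A"
      and w: "\<And>K. K \<in> cells S \<Longrightarrow> w K \<in> Pk S"
        "\<And>K \<xi>. K \<in> cells S \<Longrightarrow> \<xi> \<in> quad_nodes S \<Longrightarrow> w K \<xi> \<in> {lo S..hi S}" for K t A w
  proof (rule stage_average_bounds[OF t K A(1)])
    show "0 \<le> 2 * A" using x[OF K] A(2) by simp
    show "w K \<in> Pk S" "\<And>\<xi>. \<xi> \<in> quad_nodes S \<Longrightarrow> w K \<xi> \<in> {lo S..hi S}" using w K by blast+
    show "ext_value S w t K \<nu> \<beta> \<in> {lo S..hi S}" if "\<beta> \<in> {1..pdeg S + 1}" for \<nu> \<beta>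
      by (rule ext_value_bounds[OF t K that w])
    show "0 \<le> dt S n" using dt_pos by simp
    fix \<nu>
    \<comment> \<open>Monotonicity is a condition edge by edge, and each edge contributes at most
      the sum.\<close>
    have "lambda S n * ref_length \<nu> \<le> (\<Sum>\<nu>\<in>UNIV. lambda S n * ref_length \<nu>)"
      using lam[OF K] by (intro member_le_sum) (auto simp: less_imp_le ref_length_pos)
    then have "dt S n * (lambda S n * ref_length \<nu>) \<le> sigma_hat S * x"
      unfolding x_def using dt_pos sigma_hat_pos[of S] by simp
    also have "\<dots> \<le> sigma_hat S * A" using sigma_hat_pos[of S] A(2) by simp
    finally show "2 * dt S n * ref_length \<nu> * lambda S n \<le> sigma_hat S * (2 * A)"
      by (simp add: mult_ac)
  qed
  have u_avg: "cell_average (u K) \<in> {lo S..hi S}" if K: "K \<in> cells S" for K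
    using cell_average_bounds[OF rules(2)] poly u_bounds K by blast
  have revised: "revised S w K \<in> Pk S" "\<xi> \<in> quad_nodes S \<Longrightarrow> revised S w K \<xi> \<in> {lo S..hi S}"
    if "w K \<in> Pk S" "cell_average (w K) \<in> {lo S..hi S}" for w K \<xi>
    unfolding revised_def using limiter_in_Pk[OF that(1)] limiter_bounds[OF that(2)] by blast+
  have area_0: "0 < area_0 S n K" if K: "K \<in> cells S" for K
    using y[OF K in_slab(1)] by (simp add: area_0_def)
  have avg1: "cell_average (w1 K) \<in> {lo S..hi S}" if K: "K \<in> cells S" for K
  proof (rule in_bounds_of_mult)
    show "0 < J_1 S n K" using areas(1)[OF K] by (simp add: J_1_def)
    \<comment> \<open>At the first stage the Jacobian in use is the exact determinant; the later two
      are entered in \<open>step_jacobians\<close> as stage values.\<close>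
    have "2 * area_0 S n K \<in> step_jacobians S n K (tlev S n)"
      using area_eq[OF in_slab(1) K] by (simp add: step_jacobians_def area_0_def)
    from stage[OF K in_slab(1) this areas(6)[OF K], of u] poly u_bounds
    have "2 * area_0 S n K * cell_average (u K) + 2 * dt S n * dg_op S n K u (\<lambda>_. 1) (2 * area_0 S n K) (tlev S n)
      \<in> {lo S * J_1 S n K..hi S * J_1 S n K}"
      by (simp add: J_1_def area_1_def algebra_simps)
    \<comment> \<open>The factor 2 before \<open>dt\<close> clears the area 1/2 of the reference
      cell.\<close>
    moreover have "J_1 S n K * cell_average (w1 K) =
        J_0 S n K * cell_average (u K) + 2 * dt S n * dg_op S n K u (\<lambda>_. 1) (J_0 S n K) (tlev S n)"
      using stage1 K one by (auto simp: inner_ref_one field_simps dest!: bspec[of _ _ K] bspec[of _ _ "\<lambda>_. 1"])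
    ultimately show "J_1 S n K * cell_average (w1 K) \<in> {lo S * J_1 S n K..hi S * J_1 S n K}"
      by (simp add: J_0_def)
  qed
  have avg2: "cell_average (w2 K) \<in> {lo S..hi S}" if K: "K \<in> cells S" for K
  proof (rule in_bounds_of_mult)
    show "0 < J_2 S n K" using areas(3)[OF K] by (simp add: J_2_def)
    have "2 * area_1 S n K \<in> step_jacobians S n K (tlev S (Suc n))"
      by (simp add: step_jacobians_def J_1_def)
    from stage[OF K in_slab(2) this areas(2)[OF K], of "revised S w1"] revised avg1 stage1
    have "2 * area_1 S n K * cell_average (revised S w1 K) + 2 * dt S n * dg_op S n K (revised S w1) (\<lambda>_. 1) (2 * area_1 S n K) (tlev S (Suc n))
      \<in> {lo S * (2 * area_1 S n K + dt S n * grid_div S n K (tlev S (Suc n)) * (2 * area_1 S n K))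
        ..hi S * (2 * area_1 S n K + dt S n * grid_div S n K (tlev S (Suc n)) * (2 * area_1 S n K))}"
      by blast
    moreover have "2 * area_0 S n K * cell_average (u K) \<in> {lo S * (2 * area_0 S n K)..hi S * (2 * area_0 S n K)}"
      using area_0[OF K] u_avg[OF K] by (simp add: mult.commute)
    \<comment> \<open>A convex combination of the old cell and an Euler step from the limited stage;
      the bounds carry the Jacobians as factors, which combine to \<open>J_2\<close>.\<close>
    moreover have "J_2 S n K * cell_average (w2 K) = 3/4 * (2 * area_0 S n K * cell_average (u K))
      + 1/4 * (2 * area_1 S n K * cell_average (revised S w1 K)
        + 2 * dt S n * dg_op S n K (revised S w1) (\<lambda>_. 1) (2 * area_1 S n K) (tlev S (Suc n)))"
      using stage2 K one by (auto simp: inner_ref_one field_simps J_0_def J_1_def dest!: bspec[of _ _ K] bspec[of _ _ "\<lambda>_. 1"])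
    ultimately show "J_2 S n K * cell_average (w2 K) \<in> {lo S * J_2 S n K..hi S * J_2 S n K}"
      by (simp add: J_2_def area_2_def algebra_simps)
  qed
  have avg3: "cell_average (w3 K) \<in> {lo S..hi S}" if K: "K \<in> cells S" for K
  proof (rule in_bounds_of_mult)
    show "0 < J_3 S n K" using areas(5)[OF K] by (simp add: J_3_def)
    have "2 * area_2 S n K \<in> step_jacobians S n K (tmid S n)"
      by (simp add: step_jacobians_def J_2_def)
    from stage[OF K in_slab(3) this areas(4)[OF K], of "revised S w2"] revised avg2 stage2
    have "2 * area_2 S n K * cell_average (revised S w2 K) + 2 * dt S n * dg_op S n K (revised S w2) (\<lambda>_. 1) (2 * area_2 S n K) (tmid S n)
      \<in> {lo S * (2 * area_2 S n K + dt S n * grid_div S n K (tmid S n) * (2 * area_2 S n K))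
        ..hi S * (2 * area_2 S n K + dt S n * grid_div S n K (tmid S n) * (2 * area_2 S n K))}"
      by blast
    moreover have "2 * area_0 S n K * cell_average (u K) \<in> {lo S * (2 * area_0 S n K)..hi S * (2 * area_0 S n K)}"
      using area_0[OF K] u_avg[OF K] by (simp add: mult.commute)
    moreover have "J_3 S n K * cell_average (w3 K) = 1/3 * (2 * area_0 S n K * cell_average (u K))
      + 2/3 * (2 * area_2 S n K * cell_average (revised S w2 K)
        + 2 * dt S n * dg_op S n K (revised S w2) (\<lambda>_. 1) (2 * area_2 S n K) (tmid S n))"
      using stage3 K one by (auto simp: inner_ref_one field_simps J_0_def J_2_def dest!: bspec[of _ _ K] bspec[of _ _ "\<lambda>_. 1"])
    ultimately show "J_3 S n K * cell_average (w3 K) \<in> {lo S * J_3 S n K..hi S * J_3 S n K}"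
      by (simp add: J_3_def area_3_def algebra_simps)
  qed
  show ?thesis using revised(2)[of w3] avg3 stage3 by blast
qed

end
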